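(* Let $(\Omega,\mathcal F,\mathbf P)$ be a probability space, let $L^\infty=L^\infty(\Omega,\mathcal F,\mathbf P)$ be equipped with its norm topology, and let $L^\infty_+$ be the cone of ($\mathbf P$-a.s.) non-negative elements of $L^\infty$. Let $C\subset L^\infty$ be a norm closed convex cone such that $C\cap L^\infty_+=\{0\}$ and $-L^\infty_+\subset C$. Then there exists a norm continuous linear functional $\mu: L^\infty\to\mathbb R$ such that $\mu(x)>0$ for all $x\in L^\infty_+\setminus\{0\}$ and $\mu(x)\le 0$ for all $x\in C$.
   Context: $L^\infty$ is the real Banach space of equivalence classes (modulo $\mathbf P$-a.s. equality) of essentially bounded measurable real functions on $\Omega$, with the essential supremum norm. A functional $\mu$ in the dual of $L^\infty$ is called strictly positive if $\mu(x)>0$ for all $x\in L^\infty_+\setminus\{0\}$. A convex cone is a convex set containing $0$ and closed under multiplication by non-negative scalars. *)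

theory Defs
  imports "HOL-Probability.Probability" "HOL-Probability.Essential_Supremum"
begin

text \<open>
  Since \<open>L\<close>-infinity depends on the measure \<open>M\<close>, it is a set of equivalence classes
  with explicit operations rather than a type. All operations are lifted from
  representatives; the lemmas below show that they are independent of that choice.
\<close>

definition ess_bounded :: "'a measure \<Rightarrow> ('a \<Rightarrow> real) set" where
  "ess_bounded M = {f \<in> borel_measurable M. \<exists>c. AE \<omega> in M. \<bar>f \<omega>\<bar> \<le> c}"

definition ae_rel :: "'a measure \<Rightarrow> (('a \<Rightarrow> real) \<times> ('a \<Rightarrow> real)) set" where
  "ae_rel M = {(f, g). f \<in> ess_bounded M \<and> g \<in> ess_bounded M \<and> (AE \<omega> in M. f \<omega> = g \<omega>)}"

definition Linf :: "'a measure \<Rightarrow> ('a \<Rightarrow> real) set set" where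
  "Linf M = ess_bounded M // ae_rel M"

definition Linf_class :: "'a measure \<Rightarrow> ('a \<Rightarrow> real) \<Rightarrow> ('a \<Rightarrow> real) set" where
  "Linf_class M f = ae_rel M `` {f}"

definition Linf_zero :: "'a measure \<Rightarrow> ('a \<Rightarrow> real) set" where
  "Linf_zero M = Linf_class M (\<lambda>\<omega>. 0)"

definition Linf_add :: "'a measure \<Rightarrow> ('a \<Rightarrow> real) set \<Rightarrow> ('a \<Rightarrow> real) set \<Rightarrow> ('a \<Rightarrow> real) set" where
  "Linf_add M X Y = (\<Union>f\<in>X. \<Union>g\<in>Y. Linf_class M (\<lambda>\<omega>. f \<omega> + g \<omega>))"

definition Linf_scale :: "'a measure \<Rightarrow> real \<Rightarrow> ('a \<Rightarrow> real) set \<Rightarrow> ('a \<Rightarrow> real) set" where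
  "Linf_scale M c X = (\<Union>f\<in>X. Linf_class M (\<lambda>\<omega>. c * f \<omega>))"

definition Linf_minus :: "'a measure \<Rightarrow> ('a \<Rightarrow> real) set \<Rightarrow> ('a \<Rightarrow> real) set" where
  "Linf_minus M X = Linf_scale M (- 1) X"

definition Linf_norm :: "'a measure \<Rightarrow> ('a \<Rightarrow> real) set \<Rightarrow> real" where
  "Linf_norm M X = the_elem ((\<lambda>f. real_of_ereal (esssup M (\<lambda>\<omega>. ereal \<bar>f \<omega>\<bar>))) ` X)"

text \<open>
  The locale \<open>Metric_space\<close> asks for symmetry and non-negativity on the whole type,
  hence the value \<open>0\<close> outside the carrier.
\<close>

definition Linf_dist :: "'a measure \<Rightarrow> ('a \<Rightarrow> real) set \<Rightarrow> ('a \<Rightarrow> real) set \<Rightarrow> real" where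
  "Linf_dist M X Y =
    (if X \<in> Linf M \<and> Y \<in> Linf M then Linf_norm M (Linf_add M X (Linf_minus M Y)) else 0)"

definition Linf_topology :: "'a measure \<Rightarrow> ('a \<Rightarrow> real) set topology" where
  "Linf_topology M = Metric_space.mtopology (Linf M) (Linf_dist M)"

definition Linf_nonneg :: "'a measure \<Rightarrow> ('a \<Rightarrow> real) set set" where
  "Linf_nonneg M = {X \<in> Linf M. \<forall>f\<in>X. AE \<omega> in M. 0 \<le> f \<omega>}"

definition Linf_convex :: "'a measure \<Rightarrow> ('a \<Rightarrow> real) set set \<Rightarrow> bool" where
  "Linf_convex M C \<longleftrightarrow> C \<subseteq> Linf M \<and>
    (\<forall>X\<in>C. \<forall>Y\<in>C. \<forall>u\<ge>0. \<forall>v\<ge>0. u + v = 1 \<longrightarrow>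
       Linf_add M (Linf_scale M u X) (Linf_scale M v Y) \<in> C)"

definition Linf_convex_cone :: "'a measure \<Rightarrow> ('a \<Rightarrow> real) set set \<Rightarrow> bool" where
  "Linf_convex_cone M C \<longleftrightarrow> Linf_convex M C \<and> Linf_zero M \<in> C \<and>
    (\<forall>c\<ge>0. \<forall>X\<in>C. Linf_scale M c X \<in> C)"

definition Linf_linear :: "'a measure \<Rightarrow> (('a \<Rightarrow> real) set \<Rightarrow> real) \<Rightarrow> bool" where
  "Linf_linear M \<mu> \<longleftrightarrow>
    (\<forall>X\<in>Linf M. \<forall>Y\<in>Linf M. \<mu> (Linf_add M X Y) = \<mu> X + \<mu> Y) \<and>
    (\<forall>c. \<forall>X\<in>Linf M. \<mu> (Linf_scale M c X) = c * \<mu> X)"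


lemma ess_boundedI:
  "f \<in> borel_measurable M \<Longrightarrow> AE \<omega> in M. \<bar>f \<omega>\<bar> \<le> c \<Longrightarrow> f \<in> ess_bounded M"
  by (auto simp: ess_bounded_def)

lemma ess_boundedE:
  assumes "f \<in> ess_bounded M"
  obtains c where "f \<in> borel_measurable M" "AE \<omega> in M. \<bar>f \<omega>\<bar> \<le> c"
  using assms by (auto simp: ess_bounded_def)

lemma ess_bounded_const: "(\<lambda>\<omega>. c) \<in> ess_bounded M"
  by (rule ess_boundedI[of _ _ "\<bar>c\<bar>"]) auto

lemma ess_bounded_add:
  assumes "f \<in> ess_bounded M" "g \<in> ess_bounded M"
  shows "(\<lambda>\<omega>. f \<omega> + g \<omega>) \<in> ess_bounded M"
proof -
  obtain c d where c: "f \<in> borel_measurable M" "AE \<omega> in M. \<bar>f \<omega>\<bar> \<le> c"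
    and d: "g \<in> borel_measurable M" "AE \<omega> in M. \<bar>g \<omega>\<bar> \<le> d"
    using assms by (auto simp: ess_bounded_def)
  have "AE \<omega> in M. \<bar>f \<omega> + g \<omega>\<bar> \<le> c + d"
    using c(2) d(2) by eventually_elim linarith
  with c d show ?thesis by (intro ess_boundedI) auto
qed

lemma ess_bounded_scale:
  assumes "f \<in> ess_bounded M"
  shows "(\<lambda>\<omega>. c * f \<omega>) \<in> ess_bounded M"
proof -
  obtain d where d: "f \<in> borel_measurable M" "AE \<omega> in M. \<bar>f \<omega>\<bar> \<le> d"
    using assms by (rule ess_boundedE)
  have "AE \<omega> in M. \<bar>c * f \<omega>\<bar> \<le> \<bar>c\<bar> * d"
    using d(2) by eventually_elim (simp add: abs_mult mult_left_mono)
  with d show ?thesis by (intro ess_boundedI) auto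
qed

lemma equiv_ae_rel: "equiv (ess_bounded M) (ae_rel M)"
proof (rule equivI)
  show "ae_rel M \<subseteq> ess_bounded M \<times> ess_bounded M"
    by (auto simp: ae_rel_def)
  show "refl_on (ess_bounded M) (ae_rel M)"
    by (auto simp: refl_on_def ae_rel_def)
  show "sym (ae_rel M)"
    by (auto simp: sym_def ae_rel_def elim: eventually_mono)
  show "trans (ae_rel M)"
    by (auto simp: trans_def ae_rel_def)
qed

lemma Linf_class_in_Linf: "f \<in> ess_bounded M \<Longrightarrow> Linf_class M f \<in> Linf M"
  unfolding Linf_class_def Linf_def by (rule quotientI)

lemma Linf_cases:
  assumes "X \<in> Linf M"
  obtains f where "f \<in> ess_bounded M" "X = Linf_class M f"
  using assms unfolding Linf_def Linf_class_def by (rule quotientE)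

lemma in_Linf_class: "g \<in> Linf_class M f \<longleftrightarrow> (f, g) \<in> ae_rel M"
  by (simp add: Linf_class_def)

lemma Linf_class_eq_iff:
  "f \<in> ess_bounded M \<Longrightarrow> g \<in> ess_bounded M \<Longrightarrow>
    Linf_class M f = Linf_class M g \<longleftrightarrow> (AE \<omega> in M. f \<omega> = g \<omega>)"
  unfolding Linf_class_def
  by (subst eq_equiv_class_iff[OF equiv_ae_rel]) (auto simp: ae_rel_def)

lemma Linf_zero_in_Linf: "Linf_zero M \<in> Linf M"
  by (simp add: Linf_zero_def Linf_class_in_Linf ess_bounded_const)

lemma Linf_add_class:
  assumes "f \<in> ess_bounded M" "g \<in> ess_bounded M"
  shows "Linf_add M (Linf_class M f) (Linf_class M g) = Linf_class M (\<lambda>\<omega>. f \<omega> + g \<omega>)"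
proof -
  have "congruent2 (ae_rel M) (ae_rel M) (\<lambda>f g. Linf_class M (\<lambda>\<omega>. f \<omega> + g \<omega>))"
    unfolding congruent2_def
  proof clarify
    fix y1 z1 y2 z2 assume a: "(y1, z1) \<in> ae_rel M" "(y2, z2) \<in> ae_rel M"
    then have "AE \<omega> in M. y1 \<omega> = z1 \<omega>" "AE \<omega> in M. y2 \<omega> = z2 \<omega>"
      by (auto simp: ae_rel_def)
    then have "AE \<omega> in M. y1 \<omega> + y2 \<omega> = z1 \<omega> + z2 \<omega>"
      by eventually_elim simp
    with a show "Linf_class M (\<lambda>\<omega>. y1 \<omega> + y2 \<omega>) = Linf_class M (\<lambda>\<omega>. z1 \<omega> + z2 \<omega>)"
      by (subst Linf_class_eq_iff) (auto simp: ae_rel_def ess_bounded_add)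
  qed
  from UN_equiv_class2[OF equiv_ae_rel equiv_ae_rel this assms] show ?thesis
    by (simp add: Linf_add_def Linf_class_def)
qed

lemma Linf_scale_class:
  assumes "f \<in> ess_bounded M"
  shows "Linf_scale M c (Linf_class M f) = Linf_class M (\<lambda>\<omega>. c * f \<omega>)"
proof -
  have "congruent (ae_rel M) (\<lambda>f. Linf_class M (\<lambda>\<omega>. c * f \<omega>))"
    unfolding congruent_def
  proof clarify
    fix y z assume a: "(y, z) \<in> ae_rel M"
    then have "AE \<omega> in M. y \<omega> = z \<omega>" by (auto simp: ae_rel_def)
    then have "AE \<omega> in M. c * y \<omega> = c * z \<omega>" by eventually_elim simp
    with a show "Linf_class M (\<lambda>\<omega>. c * y \<omega>) = Linf_class M (\<lambda>\<omega>. c * z \<omega>)"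
      by (subst Linf_class_eq_iff) (auto simp: ae_rel_def ess_bounded_scale)
  qed
  from UN_equiv_class[OF equiv_ae_rel this assms] show ?thesis
    by (simp add: Linf_scale_def Linf_class_def)
qed

lemma Linf_minus_class:
  "f \<in> ess_bounded M \<Longrightarrow> Linf_minus M (Linf_class M f) = Linf_class M (\<lambda>\<omega>. - f \<omega>)"
  by (simp add: Linf_minus_def Linf_scale_class)

lemma Linf_diff_class:
  assumes "f \<in> ess_bounded M" "g \<in> ess_bounded M"
  shows "Linf_add M (Linf_class M f) (Linf_minus M (Linf_class M g)) =
    Linf_class M (\<lambda>\<omega>. f \<omega> - g \<omega>)"
  using Linf_add_class[of f M "\<lambda>\<omega>. - g \<omega>"] assms ess_bounded_scale[of g M "- 1"]
  by (simp add: Linf_minus_class)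

lemma Linf_norm_class:
  assumes "f \<in> ess_bounded M"
  shows "Linf_norm M (Linf_class M f) = real_of_ereal (esssup M (\<lambda>\<omega>. ereal \<bar>f \<omega>\<bar>))"
proof -
  have "esssup M (\<lambda>\<omega>. ereal \<bar>g \<omega>\<bar>) = esssup M (\<lambda>\<omega>. ereal \<bar>f \<omega>\<bar>)"
    if "g \<in> Linf_class M f" for g
  proof (rule esssup_AE_cong)
    have "AE \<omega> in M. f \<omega> = g \<omega>"
      using that by (auto simp: in_Linf_class ae_rel_def)
    then show "AE \<omega> in M. ereal \<bar>g \<omega>\<bar> = ereal \<bar>f \<omega>\<bar>"
      by eventually_elim simp
  qed (use that in \<open>auto simp: in_Linf_class ae_rel_def ess_bounded_def\<close>)
  then have "(\<lambda>g. real_of_ereal (esssup M (\<lambda>\<omega>. ereal \<bar>g \<omega>\<bar>))) ` Linf_class M f =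
      (\<lambda>g. real_of_ereal (esssup M (\<lambda>\<omega>. ereal \<bar>f \<omega>\<bar>))) ` Linf_class M f"
    by (intro image_cong refl arg_cong[where f = real_of_ereal])
  moreover have "f \<in> Linf_class M f"
    using assms by (simp add: in_Linf_class ae_rel_def)
  ultimately show ?thesis
    by (simp only: Linf_norm_def image_constant the_elem_eq)
qed

lemma Linf_nonneg_class:
  assumes "f \<in> ess_bounded M"
  shows "Linf_class M f \<in> Linf_nonneg M \<longleftrightarrow> (AE \<omega> in M. 0 \<le> f \<omega>)"
proof
  assume "Linf_class M f \<in> Linf_nonneg M"
  with assms show "AE \<omega> in M. 0 \<le> f \<omega>"
    by (auto simp: Linf_nonneg_def in_Linf_class ae_rel_def)
next
  assume f: "AE \<omega> in M. 0 \<le> f \<omega>"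
  have "AE \<omega> in M. 0 \<le> g \<omega>" if "g \<in> Linf_class M f" for g
  proof -
    have "AE \<omega> in M. f \<omega> = g \<omega>" using that by (auto simp: in_Linf_class ae_rel_def)
    with f show ?thesis by eventually_elim simp
  qed
  with assms show "Linf_class M f \<in> Linf_nonneg M"
    by (simp add: Linf_nonneg_def Linf_class_in_Linf)
qed

context prob_space
begin

lemma Linf_norm_le_iff:
  assumes f: "f \<in> ess_bounded M"
  shows "Linf_norm M (Linf_class M f) \<le> c \<longleftrightarrow> (AE \<omega> in M. \<bar>f \<omega>\<bar> \<le> c)"
proof -
  let ?e = "esssup M (\<lambda>\<omega>. ereal \<bar>f \<omega>\<bar>)"
  obtain d where m: "f \<in> borel_measurable M" and d: "AE \<omega> in M. \<bar>f \<omega>\<bar> \<le> d"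
    using f by (rule ess_boundedE)
  have m': "(\<lambda>\<omega>. ereal \<bar>f \<omega>\<bar>) \<in> borel_measurable M" using m by simp
  have le: "?e \<le> ereal b \<longleftrightarrow> (AE \<omega> in M. \<bar>f \<omega>\<bar> \<le> b)" for b
  proof
    assume "?e \<le> ereal b"
    moreover have "AE \<omega> in M. ereal \<bar>f \<omega>\<bar> \<le> ?e" by (rule esssup_AE)
    ultimately show "AE \<omega> in M. \<bar>f \<omega>\<bar> \<le> b"
      by (auto elim!: eventually_mono dest: order_trans)
  qed (use m' in \<open>auto intro!: esssup_I\<close>)
  have "esssup M (\<lambda>\<omega>. 0 :: ereal) \<le> ?e"
    by (rule esssup_mono) auto
  then have "0 \<le> ?e" by (simp add: esssup_const emeasure_space_1)
  moreover have "?e \<le> ereal d" using d le by blast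
  ultimately obtain r where r: "?e = ereal r" by (cases ?e) auto
  show ?thesis using le[of c] by (simp add: Linf_norm_class[OF f] r)
qed

lemma Linf_norm_AE:
  "f \<in> ess_bounded M \<Longrightarrow> AE \<omega> in M. \<bar>f \<omega>\<bar> \<le> Linf_norm M (Linf_class M f)"
  using Linf_norm_le_iff by blast

lemma Linf_norm_nonneg: "X \<in> Linf M \<Longrightarrow> 0 \<le> Linf_norm M X"
proof (elim Linf_cases)
  fix f assume f: "f \<in> ess_bounded M" "X = Linf_class M f"
  have "AE \<omega> in M. 0 \<le> Linf_norm M X"
    using Linf_norm_AE[OF f(1)] unfolding f(2) by eventually_elim linarith
  then show ?thesis by (simp add: AE_const)
qed

lemma Linf_dist_class:
  "f \<in> ess_bounded M \<Longrightarrow> g \<in> ess_bounded M \<Longrightarrow>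
    Linf_dist M (Linf_class M f) (Linf_class M g) = Linf_norm M (Linf_class M (\<lambda>\<omega>. f \<omega> - g \<omega>))"
  by (simp add: Linf_dist_def Linf_class_in_Linf Linf_diff_class)

lemma ess_bounded_diff:
  "f \<in> ess_bounded M \<Longrightarrow> g \<in> ess_bounded M \<Longrightarrow> (\<lambda>\<omega>. f \<omega> - g \<omega>) \<in> ess_bounded M"
  using ess_bounded_add[of f M "\<lambda>\<omega>. - g \<omega>"] ess_bounded_scale[of g M "- 1"] by simp

lemma Linf_dist_le_iff:
  "f \<in> ess_bounded M \<Longrightarrow> g \<in> ess_bounded M \<Longrightarrow>
    Linf_dist M (Linf_class M f) (Linf_class M g) \<le> c \<longleftrightarrow> (AE \<omega> in M. \<bar>f \<omega> - g \<omega>\<bar> \<le> c)"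
  by (simp add: Linf_dist_class Linf_norm_le_iff ess_bounded_diff)

lemma Metric_space_Linf: "Metric_space (Linf M) (Linf_dist M)"
proof
  fix X Y :: "('a \<Rightarrow> real) set"
  show nonneg: "0 \<le> Linf_dist M X Y"
  proof (cases "X \<in> Linf M \<and> Y \<in> Linf M")
    case True
    then obtain f g where "f \<in> ess_bounded M" "X = Linf_class M f"
      "g \<in> ess_bounded M" "Y = Linf_class M g"
      by (meson Linf_cases)
    then show ?thesis
      by (simp add: Linf_dist_class Linf_norm_nonneg Linf_class_in_Linf ess_bounded_diff)
  qed (auto simp: Linf_dist_def)
  show "Linf_dist M X Y = Linf_dist M Y X"
  proof (cases "X \<in> Linf M \<and> Y \<in> Linf M")
    case True
    then obtain f g where fg: "f \<in> ess_bounded M" "X = Linf_class M f"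
      "g \<in> ess_bounded M" "Y = Linf_class M g"
      by (meson Linf_cases)
    have "Linf_dist M X Y \<le> c \<longleftrightarrow> Linf_dist M Y X \<le> c" for c
      using fg by (simp add: Linf_dist_le_iff abs_minus_commute)
    then show ?thesis by (meson order_antisym order_refl)
  qed (auto simp: Linf_dist_def)
  assume "X \<in> Linf M" "Y \<in> Linf M"
  then obtain f g where fg: "f \<in> ess_bounded M" "X = Linf_class M f"
    "g \<in> ess_bounded M" "Y = Linf_class M g"
    by (meson Linf_cases)
  have "Linf_dist M X Y = 0 \<longleftrightarrow> Linf_dist M X Y \<le> 0" using nonneg by linarith
  then show "Linf_dist M X Y = 0 \<longleftrightarrow> X = Y"
    using fg by (simp add: Linf_dist_le_iff Linf_class_eq_iff)
next
  fix X Y Z assume "X \<in> Linf M" "Y \<in> Linf M" "Z \<in> Linf M"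
  then obtain f g h where fgh: "f \<in> ess_bounded M" "X = Linf_class M f"
    "g \<in> ess_bounded M" "Y = Linf_class M g" "h \<in> ess_bounded M" "Z = Linf_class M h"
    by (meson Linf_cases)
  have "AE \<omega> in M. \<bar>f \<omega> - g \<omega>\<bar> \<le> Linf_dist M X Y" "AE \<omega> in M. \<bar>g \<omega> - h \<omega>\<bar> \<le> Linf_dist M Y Z"
    using fgh Linf_dist_le_iff by blast+
  then have "AE \<omega> in M. \<bar>f \<omega> - h \<omega>\<bar> \<le> Linf_dist M X Y + Linf_dist M Y Z"
    by eventually_elim linarith
  then show "Linf_dist M X Z \<le> Linf_dist M X Y + Linf_dist M Y Z"
    using fgh by (simp add: Linf_dist_le_iff)
qed

lemma topspace_Linf_topology: "topspace (Linf_topology M) = Linf M"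
  by (simp add: Linf_topology_def Metric_space.topspace_mtopology[OF Metric_space_Linf])

end

end

theory Submission
  imports Defs
begin

text \<open>
  Fix an event \<open>A\<close> of positive probability and consider the convex set of all \<open>h\<close> with
  \<open>0 \<le> h \<le> 1\<^sub>A\<close> and \<open>E h \<ge> (1 - \<epsilon>) P(A)\<close>. For some \<open>\<epsilon> > 0\<close> it has positive distance
  from \<open>C\<close>: otherwise choose such \<open>h\<^sub>n\<close> for \<open>\<epsilon>\<^sub>n = (1/2)^(n+3)\<close> at distance less than \<open>1/(n+1)\<close>
  from \<open>C\<close>. By Markov's inequality the events \<open>A \<inter> {h\<^sub>n < 1/2}\<close> do not cover \<open>A\<close>, so
  some \<open>F \<subseteq> A\<close> of positive probability satisfies \<open>1\<^sub>F / 2 \<le> h\<^sub>n\<close> for all \<open>n\<close>; since \<open>C\<close> is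
  closed and contains the non-positive functions, \<open>1\<^sub>F / 2 \<in> C\<close>, a contradiction. Separation
  now gives a functional, non-positive on \<open>C\<close>, whose null sets inside \<open>A\<close> all have probability
  less than \<open>(1 - \<epsilon>) P(A)\<close>.

  By taking countable convex combinations, choose a functional that is non-positive on \<open>C\<close> and
  for which the supremum \<open>S\<close> of the probabilities of its null sets is minimal. Its null sets have
  an essential union \<open>Z\<close> with \<open>P(Z) = S\<close>. If \<open>S > 0\<close>, averaging with the functional obtained
  for \<open>A = Z\<close> would decrease \<open>S\<close>; so \<open>S = 0\<close> and the functional is strictly positive.
\<close>

section \<open>Separation of cones of essentially bounded functions\<close>

text \<open>The cone consists of functions rather than classes. Containing every a.e. non-positive
  function makes it closed downwards (\<open>ess_cone_mono\<close>), hence indifferent to changes on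
  null sets.\<close>

definition ess_cone :: "'a measure \<Rightarrow> ('a \<Rightarrow> real) set \<Rightarrow> bool" where
  "ess_cone M K \<longleftrightarrow> K \<subseteq> ess_bounded M \<and>
    (\<forall>f\<in>K. \<forall>g\<in>K. (\<lambda>\<omega>. f \<omega> + g \<omega>) \<in> K) \<and>
    (\<forall>c\<ge>0. \<forall>f\<in>K. (\<lambda>\<omega>. c * f \<omega>) \<in> K) \<and>
    (\<forall>f\<in>ess_bounded M. (AE \<omega> in M. f \<omega> \<le> 0) \<longrightarrow> f \<in> K)"

text \<open>The normalisation at the constant 1 excludes the zero functional. When \<open>K\<close>
  is an \<open>ess_cone\<close> it also bounds \<open>\<nu>\<close> by the essential supremum norm
  (\<open>ess_functional_abs_le\<close>), so continuity is automatic.\<close>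

definition ess_functional :: "'a measure \<Rightarrow> ('a \<Rightarrow> real) set \<Rightarrow> (('a \<Rightarrow> real) \<Rightarrow> real) \<Rightarrow> bool" where
  "ess_functional M K \<nu> \<longleftrightarrow>
    (\<forall>f\<in>ess_bounded M. \<forall>g\<in>ess_bounded M. \<nu> (\<lambda>\<omega>. f \<omega> + g \<omega>) = \<nu> f + \<nu> g) \<and>
    (\<forall>c. \<forall>f\<in>ess_bounded M. \<nu> (\<lambda>\<omega>. c * f \<omega>) = c * \<nu> f) \<and>
    \<nu> (\<lambda>\<omega>. 1) = 1 \<and> (\<forall>f\<in>K. \<nu> f \<le> 0)"

section \<open>Elementary properties of cones\<close>

lemma ess_coneD:
  assumes "ess_cone M K"
  shows ess_cone_ess_bounded: "f \<in> K \<Longrightarrow> f \<in> ess_bounded M"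
    and ess_cone_add: "f \<in> K \<Longrightarrow> g \<in> K \<Longrightarrow> (\<lambda>\<omega>. f \<omega> + g \<omega>) \<in> K"
    and ess_cone_scale: "0 \<le> c \<Longrightarrow> f \<in> K \<Longrightarrow> (\<lambda>\<omega>. c * f \<omega>) \<in> K"
    and ess_cone_nonpos: "f \<in> ess_bounded M \<Longrightarrow> AE \<omega> in M. f \<omega> \<le> 0 \<Longrightarrow> f \<in> K"
  using assms by (auto simp: ess_cone_def)

lemma ess_cone_const:
  assumes "ess_cone M K" "c \<le> 0"
  shows "(\<lambda>\<omega>. c) \<in> K"
  using assms by (intro ess_cone_nonpos[of M K]) (auto simp: ess_bounded_const)

lemma ess_cone_mono:
  assumes K: "ess_cone M K" and g: "g \<in> K" and f: "f \<in> ess_bounded M"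
    and le: "AE \<omega> in M. f \<omega> \<le> g \<omega>"
  shows "f \<in> K"
proof -
  have "(\<lambda>\<omega>. f \<omega> + - 1 * g \<omega>) \<in> ess_bounded M"
    using f ess_cone_ess_bounded[OF K g] by (intro ess_bounded_add ess_bounded_scale)
  moreover have "AE \<omega> in M. f \<omega> + - 1 * g \<omega> \<le> 0"
    using le by eventually_elim simp
  ultimately have "(\<lambda>\<omega>. f \<omega> + - 1 * g \<omega>) \<in> K"
    by (rule ess_cone_nonpos[OF K])
  from ess_cone_add[OF K this g] show ?thesis by simp
qed

text \<open>Two scaled generators merge into one: \<open>c d + c' d'\<close> is
  \<open>c + c'\<close> times a convex combination of \<open>d\<close> and \<open>d'\<close>.
  Keeping \<open>K\<close> as a separate part of the union covers \<open>c = 0\<close> and an empty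
  \<open>D\<close>.\<close>

lemma ess_cone_adjoin:
  assumes K: "ess_cone M K" and D: "D \<subseteq> ess_bounded M"
    and conv: "\<And>f g u v. f \<in> D \<Longrightarrow> g \<in> D \<Longrightarrow> 0 < u \<Longrightarrow> 0 < v \<Longrightarrow> u + v = 1 \<Longrightarrow>
      (\<lambda>\<omega>. u * f \<omega> + v * g \<omega>) \<in> D"
  defines "L \<equiv> K \<union> {\<lambda>\<omega>. k \<omega> + c * d \<omega> |k c d. k \<in> K \<and> 0 < c \<and> d \<in> D}"
  shows "ess_cone M L"
proof -
  have LI: "(\<lambda>\<omega>. k \<omega> + c * d \<omega>) \<in> L" if "k \<in> K" "0 \<le> c" "d \<in> D" for k c d
  proof (cases "c = 0")
    case False
    then have "0 < c" using that(2) by simp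
    then show ?thesis using that unfolding L_def by blast
  qed (use that in \<open>simp add: L_def\<close>)
  have mix: "(\<lambda>\<omega>. f \<omega> + g \<omega>) \<in> L" if f: "f \<in> K" and g: "g \<in> L" for f g
  proof (cases "g \<in> K")
    case True
    then show ?thesis using f ess_cone_add[OF K] by (auto simp: L_def)
  next
    case False
    then obtain k c d where g: "g = (\<lambda>\<omega>. k \<omega> + c * d \<omega>)" "k \<in> K" "0 < c" "d \<in> D"
      using g unfolding L_def by blast
    from LI[OF ess_cone_add[OF K f g(2)], of c d] g show ?thesis
      by (simp add: add.assoc)
  qed
  show ?thesis
    unfolding ess_cone_def
  proof (intro conjI ballI allI impI)
    show "L \<subseteq> ess_bounded M"
      using D ess_cone_ess_bounded[OF K]
      by (auto simp: L_def intro!: ess_bounded_add ess_bounded_scale)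
  next
    fix f g assume f: "f \<in> L" and g: "g \<in> L"
    show "(\<lambda>\<omega>. f \<omega> + g \<omega>) \<in> L"
    proof (cases "f \<in> K \<or> g \<in> K")
      case True
      then show ?thesis using mix[of f g] mix[of g f] f g by (auto simp: add.commute)
    next
      case False
      then obtain k c d k' c' d'
        where fg: "f = (\<lambda>\<omega>. k \<omega> + c * d \<omega>)" "k \<in> K" "0 < c" "d \<in> D"
          "g = (\<lambda>\<omega>. k' \<omega> + c' * d' \<omega>)" "k' \<in> K" "0 < c'" "d' \<in> D"
        using f g by (auto simp: L_def)
      let ?d = "\<lambda>\<omega>. c / (c + c') * d \<omega> + c' / (c + c') * d' \<omega>"
      have "?d \<in> D"
        using fg by (intro conv) (auto simp flip: add_divide_distrib)
      from LI[OF ess_cone_add[OF K fg(2,6)] _ this, of "c + c'"] fg(3,7)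
      have "(\<lambda>\<omega>. k \<omega> + k' \<omega> + (c + c') * ?d \<omega>) \<in> L" by simp
      also have "(\<lambda>\<omega>. k \<omega> + k' \<omega> + (c + c') * ?d \<omega>) = (\<lambda>\<omega>. f \<omega> + g \<omega>)"
        using fg(3,7) by (simp add: fg(1,5) distrib_left fun_eq_iff)
      finally show ?thesis .
    qed
  next
    fix a :: real and f assume a: "0 \<le> a" and f: "f \<in> L"
    show "(\<lambda>\<omega>. a * f \<omega>) \<in> L"
    proof (cases "f \<in> K")
      case True
      then show ?thesis using a ess_cone_scale[OF K] by (auto simp: L_def)
    next
      case False
      then obtain k c d where f: "f = (\<lambda>\<omega>. k \<omega> + c * d \<omega>)" "k \<in> K" "0 < c" "d \<in> D"
        using f by (auto simp: L_def)
      from LI[OF ess_cone_scale[OF K a f(2)] _ f(4), of "a * c"] a f(1,3) show ?thesis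
        by (simp add: distrib_left mult.assoc)
    qed
  next
    fix f assume "f \<in> ess_bounded M" "AE \<omega> in M. f \<omega> \<le> 0"
    then show "f \<in> L" using ess_cone_nonpos[OF K] by (auto simp: L_def)
  qed
qed

text \<open>Zorn's lemma applies because the union of a chain of cones omitting 1 is again such a
  cone. If a maximal cone omitted both \<open>f\<close> and \<open>- f\<close>, adjoining either
  would produce 1, and the two resulting representations of 1 combine to put 1 into the cone
  itself.\<close>

lemma ess_cone_maximal:
  assumes K: "ess_cone M K" and one: "(\<lambda>\<omega>. 1) \<notin> K"
  obtains L where "ess_cone M L" "K \<subseteq> L" "(\<lambda>\<omega>. 1) \<notin> L"
    "\<And>f. f \<in> ess_bounded M \<Longrightarrow> f \<in> L \<or> (\<lambda>\<omega>. - f \<omega>) \<in> L"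
proof -
  let ?A = "{L. ess_cone M L \<and> K \<subseteq> L \<and> (\<lambda>\<omega>. 1) \<notin> L}"
  have "\<exists>L\<in>?A. \<forall>X\<in>?A. L \<subseteq> X \<longrightarrow> X = L"
  proof (rule subset_Zorn_nonempty)
    show "?A \<noteq> {}" using K one by blast
  next
    fix \<C> assume ne: "\<C> \<noteq> {}" and ch: "subset.chain ?A \<C>"
    then have sub: "\<C> \<subseteq> ?A" and tot: "\<And>X Y. X \<in> \<C> \<Longrightarrow> Y \<in> \<C> \<Longrightarrow> X \<subseteq> Y \<or> Y \<subseteq> X"
      by (auto simp: subset_chain_def)
    have "ess_cone M (\<Union>\<C>)"
      unfolding ess_cone_def
    proof (intro conjI ballI allI impI)
      show "\<Union>\<C> \<subseteq> ess_bounded M"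
        using sub by (auto dest: ess_cone_ess_bounded)
    next
      fix f g assume "f \<in> \<Union>\<C>" "g \<in> \<Union>\<C>"
      then obtain X where "X \<in> \<C>" "f \<in> X" "g \<in> X" using tot by blast
      then show "(\<lambda>\<omega>. f \<omega> + g \<omega>) \<in> \<Union>\<C>"
        using sub ess_cone_add[of M X f g] by blast
    next
      fix c :: real and f assume "0 \<le> c" "f \<in> \<Union>\<C>"
      then show "(\<lambda>\<omega>. c * f \<omega>) \<in> \<Union>\<C>"
        using sub ess_cone_scale[of M _ c f] by blast
    next
      fix f assume "f \<in> ess_bounded M" "AE \<omega> in M. f \<omega> \<le> 0"
      then show "f \<in> \<Union>\<C>" using ne sub ess_cone_nonpos[of M _ f] by blast
    qed
    then show "\<Union>\<C> \<in> ?A" using ne sub by blast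
  qed
  then obtain L where "L \<in> ?A" and max: "\<forall>X\<in>?A. L \<subseteq> X \<longrightarrow> X = L" ..
  then have L: "ess_cone M L" "K \<subseteq> L" "(\<lambda>\<omega>. 1) \<notin> L" by simp_all
  have rep: "\<exists>k c. k \<in> L \<and> 0 < c \<and> (\<forall>\<omega>. 1 = k \<omega> + c * f \<omega>)"
    if f: "f \<in> ess_bounded M" "f \<notin> L" for f
  proof -
    let ?X = "L \<union> {\<lambda>\<omega>. k \<omega> + c * d \<omega> |k c d. k \<in> L \<and> 0 < c \<and> d \<in> {f}}"
    have "ess_cone M ?X"
      using f(1) by (intro ess_cone_adjoin L(1)) (auto simp flip: distrib_right)
    moreover have "(\<lambda>\<omega>. 0) \<in> L" by (rule ess_cone_const[OF L(1)]) simp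
    then have "(\<lambda>\<omega>. 0 + 1 * f \<omega>) \<in> ?X"
      by (intro UnI2 CollectI exI[of _ "\<lambda>\<omega>. 0"] exI[of _ 1] exI[of _ f]) simp
    then have "f \<in> ?X" by simp
    moreover have "L \<subseteq> ?X" by (rule Un_upper1)
    \<comment> \<open>\<open>?X\<close> is a cone strictly larger than \<open>L\<close>, so by
      maximality it can only violate the condition of omitting 1.\<close>
    ultimately have "(\<lambda>\<omega>. 1) \<in> ?X"
      using bspec[OF max, of ?X] L(2) f(2) by (metis (mono_tags, lifting) mem_Collect_eq order_trans)
    then obtain k c where "(\<lambda>\<omega>. 1) = (\<lambda>\<omega>. k \<omega> + c * f \<omega>)" "k \<in> L" "0 < c"
      using L(3) by blast
    then show ?thesis by (metis fun_eq_iff)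
  qed
  have "f \<in> L \<or> (\<lambda>\<omega>. - f \<omega>) \<in> L" if f: "f \<in> ess_bounded M" for f
  proof (rule ccontr)
    assume "\<not> ?thesis"
    moreover have "(\<lambda>\<omega>. - f \<omega>) \<in> ess_bounded M"
      using ess_bounded_scale[OF f, of "- 1"] by simp
    ultimately obtain k c k' c' where k: "k \<in> L" "0 < c" "\<And>\<omega>. 1 = k \<omega> + c * f \<omega>"
      and k': "k' \<in> L" "0 < c'" "\<And>\<omega>. 1 = k' \<omega> + c' * - f \<omega>"
      using rep[OF f] rep[of "\<lambda>\<omega>. - f \<omega>"] by blast
    \<comment> \<open>The weights make the multiples of \<open>f\<close> in
      \<open>k = 1 - c f\<close> and \<open>k' = 1 + c' f\<close> cancel.\<close>
    have "(\<lambda>\<omega>. c' / (c + c') * k \<omega> + c / (c + c') * k' \<omega>) \<in> L"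
      using k k' by (intro ess_cone_add[OF L(1)] ess_cone_scale[OF L(1)]) auto
    also have "(\<lambda>\<omega>. c' / (c + c') * k \<omega> + c / (c + c') * k' \<omega>) = (\<lambda>\<omega>. 1)"
    proof
      fix \<omega>
      have *: "k \<omega> = 1 - c * f \<omega>" "k' \<omega> = 1 + c' * f \<omega>" using k(3)[of \<omega>] k'(3)[of \<omega>] by auto
      have "c' / (c + c') * k \<omega> + c / (c + c') * k' \<omega> = (c' * k \<omega> + c * k' \<omega>) / (c + c')"
        by (simp add: add_divide_distrib)
      also have "c' * k \<omega> + c * k' \<omega> = c + c'"
        unfolding * by (simp add: algebra_simps)
      finally show "c' / (c + c') * k \<omega> + c / (c + c') * k' \<omega> = 1"
        using k(2) k'(2) by simp
    qed
    finally show False using L(3) by simp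
  qed
  with L show ?thesis using that by blast
qed

text \<open>
  Since a maximal cone \<open>L\<close> contains \<open>f\<close> or \<open>-f\<close> for every \<open>f\<close>, the sublinear functional
  \<open>f \<mapsto> inf {t. f - t \<in> L}\<close> is odd, hence linear.
\<close>

lemma ess_functional_exists:
  fixes M :: "'a measure"
  assumes K: "ess_cone M K" and one: "(\<lambda>\<omega>. 1) \<notin> K"
  shows "\<exists>\<nu>. ess_functional M K \<nu>"
proof -
  from ess_cone_maximal[OF K one] obtain L where L: "ess_cone M L" "K \<subseteq> L" "(\<lambda>\<omega>. 1) \<notin> L"
    and total: "\<And>f. f \<in> ess_bounded M \<Longrightarrow> f \<in> L \<or> (\<lambda>\<omega>. - f \<omega>) \<in> L"
    by blast
  define T where "T f = {t. (\<lambda>\<omega>. f \<omega> - t) \<in> L}" for f :: "'a \<Rightarrow> real"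
  \<comment> \<open>A positive constant in \<open>L\<close> could be rescaled to 1. The equivalence
    later bounds \<open>T f\<close> from below and fixes the values of \<open>\<nu>\<close> at 0 and
    1.\<close>
  have const: "(\<lambda>\<omega>. c) \<in> L \<longleftrightarrow> c \<le> 0" for c
  proof
    assume c: "(\<lambda>\<omega>. c) \<in> L"
    show "c \<le> 0"
    proof (rule ccontr)
      assume "\<not> c \<le> 0"
      then have "(\<lambda>\<omega>. inverse c * c) \<in> L" by (intro ess_cone_scale[OF L(1) _ c]) auto
      then show False using L(3) \<open>\<not> c \<le> 0\<close> by simp
    qed
  qed (rule ess_cone_const[OF L(1)])
  have ne: "T f \<noteq> {}" and bdd: "bdd_below (T f)" if f: "f \<in> ess_bounded M" for f
  proof -
    obtain b where b: "AE \<omega> in M. \<bar>f \<omega>\<bar> \<le> b" using f by (rule ess_boundedE)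
    have shift: "(\<lambda>\<omega>. f \<omega> - t) \<in> ess_bounded M" for t
      using ess_bounded_add[OF f ess_bounded_const[of "- t"]] by simp
    have "AE \<omega> in M. f \<omega> - b \<le> 0" using b by eventually_elim linarith
    then have "b \<in> T f" using ess_cone_nonpos[OF L(1) shift] by (simp add: T_def)
    then show "T f \<noteq> {}" by blast
    have "- b \<le> t" if "t \<in> T f" for t
    proof -
      have "AE \<omega> in M. - b - t \<le> f \<omega> - t" using b by eventually_elim linarith
      then have "(\<lambda>\<omega>. - b - t) \<in> L"
        using that ess_cone_mono[OF L(1)] by (auto simp: T_def ess_bounded_const)
      then show ?thesis by (simp add: const)
    qed
    then show "bdd_below (T f)" by (rule bdd_belowI)
  qed
  define \<nu> where "\<nu> f = Inf (T f)" for f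
  have le: "\<nu> f \<le> t" if "f \<in> ess_bounded M" "t \<in> T f" for f t
    unfolding \<nu>_def by (rule cInf_lower[OF that(2) bdd[OF that(1)]])
  have ge: "a \<le> \<nu> f" if "f \<in> ess_bounded M" "\<And>t. t \<in> T f \<Longrightarrow> a \<le> t" for f a
    unfolding \<nu>_def by (rule cInf_greatest[OF ne[OF that(1)] that(2)])
  have sub: "\<nu> (\<lambda>\<omega>. f \<omega> + g \<omega>) \<le> \<nu> f + \<nu> g" if fg: "f \<in> ess_bounded M" "g \<in> ess_bounded M" for f g
  proof -
    have *: "\<nu> (\<lambda>\<omega>. f \<omega> + g \<omega>) \<le> s + t" if "s \<in> T f" "t \<in> T g" for s t
    proof (rule le)
      from ess_cone_add[OF L(1)] that show "s + t \<in> T (\<lambda>\<omega>. f \<omega> + g \<omega>)"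
        by (fastforce simp: T_def algebra_simps)
    qed (use fg in \<open>rule ess_bounded_add\<close>)
    have "\<nu> (\<lambda>\<omega>. f \<omega> + g \<omega>) - s \<le> \<nu> g" if "s \<in> T f" for s
      using *[OF that] by (intro ge fg) (simp add: algebra_simps)
    then have "\<nu> (\<lambda>\<omega>. f \<omega> + g \<omega>) - \<nu> g \<le> \<nu> f"
      by (intro ge fg) (simp add: algebra_simps)
    then show ?thesis by simp
  qed
  have zero: "\<nu> (\<lambda>\<omega>. 0) = 0"
    using le[of "\<lambda>\<omega>. 0" 0] ge[of "\<lambda>\<omega>. 0" 0] by (force simp: ess_bounded_const T_def const)
  have neg: "\<nu> (\<lambda>\<omega>. - f \<omega>) = - \<nu> f" if f: "f \<in> ess_bounded M" for f
  proof (rule antisym)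
    have f': "(\<lambda>\<omega>. - f \<omega>) \<in> ess_bounded M"
      using ess_bounded_scale[OF f, of "- 1"] by simp
    show "- \<nu> f \<le> \<nu> (\<lambda>\<omega>. - f \<omega>)"
      using sub[OF f f'] zero by simp
    \<comment> \<open>Here totality of \<open>L\<close> enters: \<open>s < \<nu> f\<close> keeps
      \<open>f - s\<close> out of \<open>L\<close>, so \<open>s - f\<close> is in \<open>L\<close>,
      which makes \<open>- s\<close> an element of \<open>T (- f)\<close>.\<close>
    have "s \<le> - \<nu> (\<lambda>\<omega>. - f \<omega>)" if "s < \<nu> f" for s
    proof -
      have "s \<notin> T f" using le[OF f] that by force
      then have "(\<lambda>\<omega>. - (f \<omega> - s)) \<in> L"
        using total[OF ess_bounded_add[OF f ess_bounded_const[of "- s"]]] by (auto simp: T_def)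
      then have "- s \<in> T (\<lambda>\<omega>. - f \<omega>)" by (simp add: T_def algebra_simps)
      from le[OF f' this] show ?thesis by simp
    qed
    then have "\<nu> f \<le> - \<nu> (\<lambda>\<omega>. - f \<omega>)" by (rule dense_le)
    then show "\<nu> (\<lambda>\<omega>. - f \<omega>) \<le> - \<nu> f" by simp
  qed
  have scale_le: "\<nu> (\<lambda>\<omega>. c * f \<omega>) \<le> c * \<nu> f" if f: "f \<in> ess_bounded M" and c: "0 < c" for c f
  proof -
    have "\<nu> (\<lambda>\<omega>. c * f \<omega>) / c \<le> \<nu> f"
    proof (rule ge[OF f])
      fix t assume "t \<in> T f"
      then have "c * t \<in> T (\<lambda>\<omega>. c * f \<omega>)"
        using c ess_cone_scale[OF L(1), of c "\<lambda>\<omega>. f \<omega> - t"] by (simp add: T_def algebra_simps)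
      from le[OF ess_bounded_scale[OF f] this] show "\<nu> (\<lambda>\<omega>. c * f \<omega>) / c \<le> t"
        using c by (simp add: field_simps)
    qed
    then show ?thesis using c by (simp add: field_simps)
  qed
  have scale_pos: "\<nu> (\<lambda>\<omega>. c * f \<omega>) = c * \<nu> f" if f: "f \<in> ess_bounded M" and c: "0 < c" for c f
  proof (rule antisym[OF scale_le[OF f c]])
    \<comment> \<open>The inequality \<open>scale_le\<close>, applied to \<open>c f\<close> with the
      factor \<open>1/c\<close>, gives its own converse.\<close>
    have "\<nu> (\<lambda>\<omega>. inverse c * (c * f \<omega>)) \<le> inverse c * \<nu> (\<lambda>\<omega>. c * f \<omega>)"
      using c by (intro scale_le ess_bounded_scale f) simp
    then show "c * \<nu> f \<le> \<nu> (\<lambda>\<omega>. c * f \<omega>)"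
      using c by (simp add: field_simps)
  qed
  have "ess_functional M K \<nu>"
    unfolding ess_functional_def
  proof (intro conjI ballI allI)
    fix f g assume f: "f \<in> ess_bounded M" and g: "g \<in> ess_bounded M"
    \<comment> \<open>Since \<open>\<nu>\<close> is odd, superadditivity is subadditivity for the
      decomposition \<open>f = (f + g) - g\<close>.\<close>
    have "\<nu> (\<lambda>\<omega>. (f \<omega> + g \<omega>) + - 1 * g \<omega>) \<le> \<nu> (\<lambda>\<omega>. f \<omega> + g \<omega>) + \<nu> (\<lambda>\<omega>. - 1 * g \<omega>)"
      by (intro sub ess_bounded_add ess_bounded_scale f g)
    then have "\<nu> f + \<nu> g \<le> \<nu> (\<lambda>\<omega>. f \<omega> + g \<omega>)"
      using neg[OF g] by simp
    with sub[OF f g] show "\<nu> (\<lambda>\<omega>. f \<omega> + g \<omega>) = \<nu> f + \<nu> g" by simp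
  next
    fix c :: real and f assume f: "f \<in> ess_bounded M"
    consider "c = 0" | "0 < c" | "0 < - c" by linarith
    then show "\<nu> (\<lambda>\<omega>. c * f \<omega>) = c * \<nu> f"
    proof cases
      case 3
      then show ?thesis
        using scale_pos[OF f 3] neg[OF ess_bounded_scale[OF f, of "- c"]] by simp
    qed (use zero scale_pos[OF f] in auto)
  next
    show "\<nu> (\<lambda>\<omega>. 1) = 1"
      using le[of "\<lambda>\<omega>. 1" 1] ge[of "\<lambda>\<omega>. 1" 1] by (force simp: ess_bounded_const T_def const)
  next
    fix f assume "f \<in> K"
    then have "f \<in> ess_bounded M" "0 \<in> T f"
      using L ess_cone_ess_bounded[OF K] by (auto simp: T_def)
    then show "\<nu> f \<le> 0" by (rule le)
  qed
  then show ?thesis by blast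
qed

section \<open>Positivity, boundedness and countable mixtures of functionals\<close>

lemma ess_functionalD:
  assumes "ess_functional M K \<nu>"
  shows ess_functional_add:
      "f \<in> ess_bounded M \<Longrightarrow> g \<in> ess_bounded M \<Longrightarrow> \<nu> (\<lambda>\<omega>. f \<omega> + g \<omega>) = \<nu> f + \<nu> g"
    and ess_functional_scale: "f \<in> ess_bounded M \<Longrightarrow> \<nu> (\<lambda>\<omega>. c * f \<omega>) = c * \<nu> f"
    and ess_functional_one: "\<nu> (\<lambda>\<omega>. 1) = 1"
    and ess_functional_nonpos: "f \<in> K \<Longrightarrow> \<nu> f \<le> 0"
  using assms by (auto simp: ess_functional_def)

lemma ess_functional_const:
  assumes "ess_functional M K \<nu>"
  shows "\<nu> (\<lambda>\<omega>. c) = c"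
  using ess_functional_scale[OF assms ess_bounded_const, of c 1] ess_functional_one[OF assms] by simp

lemma ess_functional_diff:
  assumes \<nu>: "ess_functional M K \<nu>" and f: "f \<in> ess_bounded M" and g: "g \<in> ess_bounded M"
  shows "\<nu> (\<lambda>\<omega>. f \<omega> - g \<omega>) = \<nu> f - \<nu> g"
  using ess_functional_add[OF \<nu> f ess_bounded_scale[OF g, of "- 1"]]
    ess_functional_scale[OF \<nu> g, of "- 1"] by simp

text \<open>The difference \<open>f - g\<close> is a.e. non-positive, hence in the cone. Applied in
  both directions, this also shows that \<open>\<nu>\<close> depends only on the a.e. class.\<close>

lemma ess_functional_mono:
  assumes K: "ess_cone M K" and \<nu>: "ess_functional M K \<nu>"
    and f: "f \<in> ess_bounded M" and g: "g \<in> ess_bounded M" and le: "AE \<omega> in M. f \<omega> \<le> g \<omega>"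
  shows "\<nu> f \<le> \<nu> g"
proof -
  have "AE \<omega> in M. f \<omega> + - 1 * g \<omega> \<le> 0" using le by eventually_elim simp
  then have "\<nu> (\<lambda>\<omega>. f \<omega> + - 1 * g \<omega>) \<le> 0"
    by (intro ess_functional_nonpos[OF \<nu>] ess_cone_nonpos[OF K] ess_bounded_add ess_bounded_scale f g)
  then show ?thesis using ess_functional_diff[OF \<nu> f g] by simp
qed

text \<open>Monotonicity places \<open>\<nu> f\<close> between the values at the constants
  \<open>- b\<close> and \<open>b\<close>. The bound gives convergence of series of functionals and
  continuity on the quotient.\<close>

lemma ess_functional_abs_le:
  assumes K: "ess_cone M K" and \<nu>: "ess_functional M K \<nu>"
    and f: "f \<in> ess_bounded M" and b: "AE \<omega> in M. \<bar>f \<omega>\<bar> \<le> b"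
  shows "\<bar>\<nu> f\<bar> \<le> b"
proof -
  have "AE \<omega> in M. f \<omega> \<le> b" "AE \<omega> in M. - b \<le> f \<omega>" using b by (eventually_elim, linarith)+
  then have "\<nu> f \<le> \<nu> (\<lambda>\<omega>. b)" "\<nu> (\<lambda>\<omega>. - b) \<le> \<nu> f"
    by (auto intro!: ess_functional_mono[OF K \<nu>] f ess_bounded_const)
  then show ?thesis by (simp add: ess_functional_const[OF \<nu>])
qed

lemma ess_functional_subset:
  "ess_functional M L \<nu> \<Longrightarrow> K \<subseteq> L \<Longrightarrow> ess_functional M K \<nu>"
  by (auto simp: ess_functional_def)

text \<open>The weights \<open>(1/2)^Suc n\<close> sum to 1, which preserves the normalisation. On a
  non-negative \<open>f\<close> all terms are non-negative, so the sum vanishes only if each term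
  does: a null event of the mixture is null for every component.\<close>

lemma ess_functional_suminf:
  assumes K: "ess_cone M K" and \<nu>: "\<And>n. ess_functional M K (\<nu> n)"
  defines "\<mu> \<equiv> \<lambda>f. \<Sum>n. (1/2)^Suc n * \<nu> n f"
  shows "ess_functional M K \<mu>"
    and "\<And>f. f \<in> ess_bounded M \<Longrightarrow> AE \<omega> in M. 0 \<le> f \<omega> \<Longrightarrow> \<mu> f = 0 \<Longrightarrow> \<nu> n f = 0"
proof -
  have summ: "summable (\<lambda>n. (1/2)^Suc n * \<nu> n f)" if f: "f \<in> ess_bounded M" for f
  proof -
    obtain b where b: "AE \<omega> in M. \<bar>f \<omega>\<bar> \<le> b" using f by (rule ess_boundedE)
    have "summable (\<lambda>n. (1/2)^Suc n * b)"
      by (intro summable_mult2 sums_summable[OF power_half_series])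
    then show ?thesis
    proof (rule summable_comparison_test')
      fix n
      show "norm ((1/2)^Suc n * \<nu> n f) \<le> (1/2)^Suc n * b"
        using ess_functional_abs_le[OF K \<nu> f b, of n] by (simp add: abs_mult)
    qed
  qed
  show "ess_functional M K \<mu>"
    unfolding ess_functional_def
  proof (intro conjI ballI allI)
    fix f g assume f: "f \<in> ess_bounded M" and g: "g \<in> ess_bounded M"
    show "\<mu> (\<lambda>\<omega>. f \<omega> + g \<omega>) = \<mu> f + \<mu> g"
      by (simp add: \<mu>_def suminf_add[OF summ[OF f] summ[OF g]]
          ess_functional_add[OF \<nu> f g] distrib_left del: power_Suc)
  next
    fix c :: real and f assume f: "f \<in> ess_bounded M"
    show "\<mu> (\<lambda>\<omega>. c * f \<omega>) = c * \<mu> f"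
      by (simp add: \<mu>_def suminf_mult[OF summ[OF f], symmetric]
          ess_functional_scale[OF \<nu> f] mult.left_commute del: power_Suc)
  next
    show "\<mu> (\<lambda>\<omega>. 1) = 1"
      using sums_unique[OF power_half_series]
      by (simp add: \<mu>_def ess_functional_one[OF \<nu>] del: power_Suc)
  next
    fix f assume f: "f \<in> K"
    show "\<mu> f \<le> 0"
      unfolding \<mu>_def
    proof (rule suminf_le_const[OF summ[OF ess_cone_ess_bounded[OF K f]]])
      fix n show "(\<Sum>i<n. (1/2)^Suc i * \<nu> i f) \<le> 0"
        by (intro sum_nonpos mult_nonneg_nonpos ess_functional_nonpos[OF \<nu> f]) simp
    qed
  qed
  fix f assume f: "f \<in> ess_bounded M" and nn: "AE \<omega> in M. 0 \<le> f \<omega>" and 0: "\<mu> f = 0"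
  have "0 \<le> \<nu> n f" for n
    using ess_functional_mono[OF K \<nu> ess_bounded_const f nn] ess_functional_const[OF \<nu>] by simp
  then have "(1/2)^Suc n * \<nu> n f = 0" for n
    using 0 suminf_eq_zero_iff[OF summ[OF f]] by (simp add: \<mu>_def)
  then show "\<nu> n f = 0" by (simp del: power_Suc)
qed

section \<open>The local separation\<close>

text \<open>Functions with values in [0,1] replace the indicators of the large subevents of
  \<open>A\<close>, whose set need not be convex; convexity is what separation requires.\<close>

definition ess_portion :: "'a measure \<Rightarrow> 'a set \<Rightarrow> real \<Rightarrow> ('a \<Rightarrow> real) set" where
  "ess_portion M A \<epsilon> = {h \<in> ess_bounded M.
    (AE \<omega> in M. 0 \<le> h \<omega> \<and> h \<omega> \<le> indicator A \<omega>) \<and>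
    (1 - \<epsilon>) * measure M A \<le> (\<integral>\<omega>. h \<omega> \<partial>M)}"

lemma ess_bounded_indicator: "B \<in> sets M \<Longrightarrow> indicator B \<in> ess_bounded M"
  by (rule ess_boundedI[of _ _ 1]) (auto simp: indicator_def)

lemma (in prob_space) ess_bounded_integrable:
  assumes "f \<in> ess_bounded M"
  shows "integrable M f"
proof -
  obtain b where "f \<in> borel_measurable M" "AE \<omega> in M. \<bar>f \<omega>\<bar> \<le> b"
    using assms by (rule ess_boundedE)
  then show ?thesis by (intro integrable_const_bound[of _ b]) auto
qed

lemma (in prob_space) ess_portion_convex:
  assumes f: "f \<in> ess_portion M A \<epsilon>" and g: "g \<in> ess_portion M A \<epsilon>"
    and uv: "0 < u" "0 < v" "u + v = 1"
  shows "(\<lambda>\<omega>. u * f \<omega> + v * g \<omega>) \<in> ess_portion M A \<epsilon>"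
proof -
  have fg: "f \<in> ess_bounded M" "g \<in> ess_bounded M"
    and bd: "AE \<omega> in M. 0 \<le> f \<omega> \<and> f \<omega> \<le> indicator A \<omega>" "AE \<omega> in M. 0 \<le> g \<omega> \<and> g \<omega> \<le> indicator A \<omega>"
    using f g by (auto simp: ess_portion_def)
  have "AE \<omega> in M. 0 \<le> u * f \<omega> + v * g \<omega> \<and> u * f \<omega> + v * g \<omega> \<le> indicator A \<omega>"
    using bd
  proof eventually_elim
    case (elim \<omega>)
    have "u * f \<omega> + v * g \<omega> \<le> u * indicator A \<omega> + v * indicator A \<omega>"
      using elim uv by (intro add_mono mult_left_mono) auto
    also have "\<dots> = indicator A \<omega>" using uv(3) by (simp flip: distrib_right)
    finally show ?case using elim uv by simp
  qed
  moreover have "(1 - \<epsilon>) * prob A \<le> (\<integral>\<omega>. u * f \<omega> + v * g \<omega> \<partial>M)"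
  proof -
    let ?m = "(1 - \<epsilon>) * prob A"
    have "?m = u * ?m + v * ?m" using uv(3) by (simp flip: distrib_right)
    also have "\<dots> \<le> u * expectation f + v * expectation g"
      using f g uv by (intro add_mono mult_left_mono) (auto simp: ess_portion_def)
    also have "\<dots> = (\<integral>\<omega>. u * f \<omega> + v * g \<omega> \<partial>M)"
      using fg by (simp add: ess_bounded_integrable)
    finally show ?thesis .
  qed
  ultimately show ?thesis
    using fg by (auto simp: ess_portion_def intro!: ess_bounded_add ess_bounded_scale)
qed

text \<open>Markov's inequality for \<open>indicator A - h\<close>: this function is a.e.
  non-negative, has expectation at most \<open>\<epsilon> * prob A\<close> and exceeds 1/2 on the
  event.\<close>

lemma (in prob_space) ess_portion_prob_half:
  assumes h: "h \<in> ess_portion M A \<epsilon>" and A: "A \<in> events"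
  shows "prob {\<omega> \<in> A. h \<omega> < 1/2} \<le> 2 * \<epsilon> * prob A"
proof -
  have hb: "h \<in> ess_bounded M" and bd: "AE \<omega> in M. 0 \<le> h \<omega> \<and> h \<omega> \<le> indicator A \<omega>"
    and E: "(1 - \<epsilon>) * prob A \<le> expectation h"
    using h by (auto simp: ess_portion_def)
  have [measurable]: "h \<in> borel_measurable M" using hb by (auto simp: ess_bounded_def)
  note [measurable] = A
  have ev: "{\<omega> \<in> A. h \<omega> < 1/2} \<in> events"
  proof -
    have "{\<omega> \<in> A. h \<omega> < 1/2} = A \<inter> {\<omega> \<in> space M. h \<omega> < 1/2}"
      using sets.sets_into_space[OF A] by auto
    also have "\<dots> \<in> events" by measurable
    finally show ?thesis .
  qed
  have "prob {\<omega> \<in> A. h \<omega> < 1/2} = expectation (indicator {\<omega> \<in> A. h \<omega> < 1/2})"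
    using ev by simp
  also have "\<dots> \<le> expectation (\<lambda>\<omega>. 2 * (indicator A \<omega> - h \<omega>))"
  proof (rule integral_mono_AE)
    show "integrable M (indicat_real {\<omega> \<in> A. h \<omega> < 1/2})"
      using ev by (intro ess_bounded_integrable ess_bounded_indicator)
    show "integrable M (\<lambda>\<omega>. 2 * (indicator A \<omega> - h \<omega>))"
      by (intro ess_bounded_integrable ess_bounded_scale ess_bounded_diff ess_bounded_indicator A hb)
    show "AE \<omega> in M. indicat_real {\<omega> \<in> A. h \<omega> < 1/2} \<omega> \<le> 2 * (indicator A \<omega> - h \<omega>)"
      using bd by eventually_elim (auto simp: indicator_def)
  qed
  also have "\<dots> = 2 * (prob A - expectation h)"
    using A hb by (simp add: ess_bounded_integrable ess_bounded_indicator)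
  also have "\<dots> \<le> 2 * \<epsilon> * prob A"
    using E by (simp add: algebra_simps)
  finally show ?thesis .
qed

text \<open>The assumption \<open>closed\<close> is norm closedness in one-sided form: since an
  \<open>ess_cone\<close> is closed downwards, \<open>f - e\<close> lies in \<open>G\<close> exactly
  if some member of \<open>G\<close> is within distance \<open>e\<close> of
  \<open>f\<close>.\<close>

locale arbitrage_free_cone = prob_space +
  fixes G :: "('a \<Rightarrow> real) set"
  assumes cone: "ess_cone M G"
    and closed: "\<And>f. f \<in> ess_bounded M \<Longrightarrow> (\<And>e. 0 < e \<Longrightarrow> (\<lambda>\<omega>. f \<omega> - e) \<in> G) \<Longrightarrow> f \<in> G"
    and no_arbitrage: "\<And>f. f \<in> G \<Longrightarrow> AE \<omega> in M. 0 \<le> f \<omega> \<Longrightarrow> AE \<omega> in M. f \<omega> = 0"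
begin

section \<open>Separating the large portions of an event from the cone\<close>

lemma one_notin: "(\<lambda>\<omega>. 1) \<notin> G"
proof
  assume "(\<lambda>\<omega>. 1) \<in> G"
  from no_arbitrage[OF this] show False by (simp add: AE_const)
qed

text \<open>Because \<open>G\<close> is closed downwards, \<open>h - s \<in> G\<close> with
  \<open>s \<ge> 0\<close> says that \<open>h\<close> has distance at most \<open>s\<close> from
  \<open>G\<close>; so \<open>\<delta>\<close> bounds the distance from the portion to
  \<open>G\<close> from below.\<close>

lemma gap:
  assumes A: "A \<in> events" and pos: "0 < prob A"
  obtains \<epsilon> \<delta> where "0 < \<epsilon>" "0 < \<delta>"
    "\<And>h s. h \<in> ess_portion M A \<epsilon> \<Longrightarrow> (\<lambda>\<omega>. h \<omega> - s) \<in> G \<Longrightarrow> \<delta> \<le> s"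
proof (rule ccontr)
  assume no: "\<not> thesis"
  \<comment> \<open>With this exponent the bound \<open>2 * \<epsilon> * prob A\<close> for the n-th
    exceptional event \<open>E n\<close> becomes \<open>(1/2)^Suc n * (prob A / 2)\<close>; summed
    over all \<open>n\<close> from 0 this is only half of \<open>prob A\<close>.\<close>
  have "\<exists>h s. h \<in> ess_portion M A ((1/2)^(n + 3)) \<and> (\<lambda>\<omega>. h \<omega> - s) \<in> G \<and> s < inverse (real (Suc n))" for n
  proof (rule ccontr)
    assume "\<not> ?thesis"
    then show False
      using no that[of "(1/2)^(n + 3)" "inverse (real (Suc n))"] by (auto simp: not_less)
  qed
  then obtain h s where h: "\<And>n. h n \<in> ess_portion M A ((1/2)^(n + 3))"
    and hs: "\<And>n. (\<lambda>\<omega>. h n \<omega> - s n) \<in> G" and s: "\<And>n. s n < inverse (real (Suc n))"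
    by metis
  have hb: "h n \<in> ess_bounded M" and hnn: "AE \<omega> in M. 0 \<le> h n \<omega>" for n
    using h[of n] by (auto simp: ess_portion_def)
  define E where "E n = {\<omega> \<in> A. h n \<omega> < 1/2}" for n
  define F where "F = A - (\<Union>n. E n)"
  have E_ev: "E n \<in> events" for n
  proof -
    have [measurable]: "h n \<in> borel_measurable M" using hb by (auto simp: ess_bounded_def)
    have "E n = A \<inter> {\<omega> \<in> space M. h n \<omega> < 1/2}"
      using sets.sets_into_space[OF A] by (auto simp: E_def)
    also have "\<dots> \<in> events" using A by measurable
    finally show ?thesis .
  qed
  have F_ev: "F \<in> events" using A E_ev by (auto simp: F_def)
  have sums: "(\<lambda>n. (1/2)^Suc n * (prob A / 2)) sums (prob A / 2)"
    using sums_mult2[OF power_half_series, of "prob A / 2"] by simp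
  have prob_E: "prob (E n) \<le> (1/2)^Suc n * (prob A / 2)" for n
    using ess_portion_prob_half[OF h A, of n] by (simp add: E_def power_add power3_eq_cube)
  have summ: "summable (\<lambda>n. prob (E n))"
    by (rule summable_comparison_test'[OF sums_summable[OF sums]]) (use prob_E in auto)
  have "prob (\<Union>n. E n) \<le> (\<Sum>n. prob (E n))"
    by (rule finite_measure_subadditive_countably) (use E_ev summ in auto)
  also have "\<dots> \<le> (\<Sum>n. (1/2)^Suc n * (prob A / 2))"
    by (rule suminf_le[OF prob_E summ sums_summable[OF sums]])
  also have "\<dots> = prob A / 2" using sums by (rule sums_unique[symmetric])
  finally have "prob (\<Union>n. E n) \<le> prob A / 2" .
  moreover have "prob F = prob A - prob (\<Union>n. E n)"
    unfolding F_def using A E_ev by (intro finite_measure_Diff) (auto simp: E_def)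
  ultimately have F_pos: "0 < prob F" using pos by simp
  let ?f = "\<lambda>\<omega>. 1/2 * indicat_real F \<omega>"
  have fb: "?f \<in> ess_bounded M" by (intro ess_bounded_scale ess_bounded_indicator F_ev)
  have "?f \<in> G"
  proof (rule closed[OF fb])
    fix e :: real assume "0 < e"
    then obtain n where n: "inverse (real (Suc n)) < e" using reals_Archimedean by blast
    \<comment> \<open>On \<open>F\<close> every \<open>h n\<close> is at least 1/2, and off
      \<open>F\<close> the left side is \<open>- e\<close> while \<open>h n\<close> is a.e.
      non-negative; in both cases \<open>s n < e\<close> gives the domination by a member of
      \<open>G\<close>.\<close>
    have "AE \<omega> in M. ?f \<omega> - e \<le> h n \<omega> - s n"
      using hnn[of n]
    proof eventually_elim
      case (elim \<omega>)
      have "1/2 \<le> h n \<omega>" if "\<omega> \<in> F" using that by (auto simp: F_def E_def not_less)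
      with elim s[of n] n show ?case by (auto simp: indicator_def)
    qed
    moreover have "(\<lambda>\<omega>. ?f \<omega> - e) \<in> ess_bounded M"
      using ess_bounded_add[OF fb ess_bounded_const[of "- e"]] by simp
    ultimately show "(\<lambda>\<omega>. ?f \<omega> - e) \<in> G"
      by (intro ess_cone_mono[OF cone hs[of n]])
  qed
  then have "AE \<omega> in M. ?f \<omega> = 0" by (rule no_arbitrage) simp
  then have "AE \<omega> in M. \<omega> \<notin> F" by eventually_elim (auto simp: indicator_def split: if_splits)
  then have "prob F = 0" using F_ev by (simp add: prob_eq_0)
  with F_pos show False by simp
qed

text \<open>The indicator of an event \<open>B \<subseteq> A\<close> of probability at least
  \<open>(1 - \<epsilon>) * prob A\<close> belongs to the portion, on which the separating
  functional is at least \<open>\<delta> > 0\<close>; such a \<open>B\<close> cannot be null for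
  it.\<close>

lemma local_functional:
  assumes A: "A \<in> events" and pos: "0 < prob A"
  obtains \<nu> \<epsilon> where "ess_functional M G \<nu>" "0 < \<epsilon>"
    "\<And>B. B \<in> events \<Longrightarrow> B \<subseteq> A \<Longrightarrow> \<nu> (indicator B) = 0 \<Longrightarrow> prob B < (1 - \<epsilon>) * prob A"
proof -
  obtain \<epsilon> \<delta> where e: "0 < \<epsilon>" and d: "0 < \<delta>"
    and gap: "\<And>h s. h \<in> ess_portion M A \<epsilon> \<Longrightarrow> (\<lambda>\<omega>. h \<omega> - s) \<in> G \<Longrightarrow> \<delta> \<le> s"
    using gap[OF A pos] by blast
  \<comment> \<open>A functional that is at most \<open>0\<close> at \<open>\<delta> - h\<close> and \<open>1\<close> at \<open>1\<close> is at least \<open>\<delta>\<close> at \<open>h\<close>.\<close>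
  let ?D = "(\<lambda>h \<omega>. \<delta> - h \<omega>) ` ess_portion M A \<epsilon>"
  define K where "K = G \<union> {\<lambda>\<omega>. k \<omega> + c * d \<omega> |k c d. k \<in> G \<and> 0 < c \<and> d \<in> ?D}"
  have K: "ess_cone M K"
    unfolding K_def
  proof (rule ess_cone_adjoin[OF cone])
    show "?D \<subseteq> ess_bounded M"
      by (auto simp: ess_portion_def intro!: ess_bounded_diff ess_bounded_const)
  next
    fix f g and u v :: real assume "f \<in> ?D" "g \<in> ?D" and uv: "0 < u" "0 < v" "u + v = 1"
    then obtain h h' where h: "h \<in> ess_portion M A \<epsilon>" "f = (\<lambda>\<omega>. \<delta> - h \<omega>)"
      and h': "h' \<in> ess_portion M A \<epsilon>" "g = (\<lambda>\<omega>. \<delta> - h' \<omega>)" by blast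
    have "u * f \<omega> + v * g \<omega> = \<delta> - (u * h \<omega> + v * h' \<omega>)" for \<omega>
    proof -
      have "u * f \<omega> + v * g \<omega> = (u + v) * \<delta> - (u * h \<omega> + v * h' \<omega>)"
        by (simp add: h h' algebra_simps)
      then show ?thesis using uv(3) by simp
    qed
    then show "(\<lambda>\<omega>. u * f \<omega> + v * g \<omega>) \<in> ?D"
      using ess_portion_convex[OF h(1) h'(1) uv] by (intro image_eqI) auto
  qed
  have "(\<lambda>\<omega>. 1) \<notin> K"
  proof
    assume "(\<lambda>\<omega>. 1) \<in> K"
    then obtain k c h where k: "k \<in> G" "0 < c" "h \<in> ess_portion M A \<epsilon>"
      and eq: "(\<lambda>\<omega>. 1) = (\<lambda>\<omega>. k \<omega> + c * (\<delta> - h \<omega>))"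
      using one_notin unfolding K_def by blast
    \<comment> \<open>Dividing by \<open>c\<close> puts \<open>h - (\<delta> - 1/c)\<close> into
      \<open>G\<close>, and the gap would force
      \<open>\<delta> \<le> \<delta> - 1/c\<close>.\<close>
    have "inverse c * k \<omega> = h \<omega> - (\<delta> - inverse c)" for \<omega>
      using fun_cong[OF eq, of \<omega>] k(2) by (simp add: field_simps)
    then have "(\<lambda>\<omega>. h \<omega> - (\<delta> - inverse c)) \<in> G"
      using ess_cone_scale[OF cone _ k(1), of "inverse c"] k(2) by simp
    from gap[OF k(3) this] show False using k(2) by simp
  qed
  from ess_functional_exists[OF K this] obtain \<nu> where \<nu>: "ess_functional M K \<nu>" ..
  have \<nu>G: "ess_functional M G \<nu>"
    using \<nu> by (rule ess_functional_subset) (simp add: K_def)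
  have "\<delta> \<le> \<nu> h" if h: "h \<in> ess_portion M A \<epsilon>" for h
  proof -
    have hb: "h \<in> ess_bounded M" using h by (simp add: ess_portion_def)
    have "(\<lambda>\<omega>. 0) \<in> G" by (rule ess_cone_const[OF cone]) simp
    then have "(\<lambda>\<omega>. 0 + 1 * (\<delta> - h \<omega>)) \<in> K"
      unfolding K_def using h
      by (intro UnI2 CollectI exI[of _ "\<lambda>\<omega>. 0"] exI[of _ 1] exI[of _ "\<lambda>\<omega>. \<delta> - h \<omega>"]) auto
    then have "\<nu> (\<lambda>\<omega>. 0 + 1 * (\<delta> - h \<omega>)) \<le> 0" by (rule ess_functional_nonpos[OF \<nu>])
    moreover have "\<nu> (\<lambda>\<omega>. \<delta> - h \<omega>) = \<delta> - \<nu> h"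
      using ess_functional_diff[OF \<nu> ess_bounded_const hb] ess_functional_const[OF \<nu>] by simp
    ultimately show ?thesis by simp
  qed
  moreover have "indicator B \<in> ess_portion M A \<epsilon>"
    if "B \<in> events" "B \<subseteq> A" "(1 - \<epsilon>) * prob A \<le> prob B" for B
    using that by (auto simp: ess_portion_def ess_bounded_indicator indicator_def)
  ultimately have "prob B < (1 - \<epsilon>) * prob A"
    if "B \<in> events" "B \<subseteq> A" "\<nu> (indicator B) = 0" for B
    using that d by (metis not_less order.strict_trans2 order_less_irrefl)
  with \<nu>G e show ?thesis using that by blast
qed

subsection \<open>Exhaustion\<close>

text \<open>An exhaustion argument in the style of the Halmos-Savage theorem; testing on indicators
  suffices by \<open>ess_functional_pos\<close>.\<close>

lemma strictly_positive_functional: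
  obtains \<nu> where "ess_functional M G \<nu>" "\<And>B. B \<in> events \<Longrightarrow> \<nu> (indicator B) = 0 \<Longrightarrow> prob B = 0"
proof -
  define N where "N \<nu> = {B \<in> events. \<nu> (indicator B) = 0}" for \<nu> :: "('a \<Rightarrow> real) \<Rightarrow> real"
  define s where "s \<nu> = (SUP B\<in>N \<nu>. prob B)" for \<nu>
  let ?F = "{\<nu>. ess_functional M G \<nu>}"
  have N_nn: "0 \<le> \<nu> (indicator B)" if "\<nu> \<in> ?F" "B \<in> events" for \<nu> B
    using ess_functional_mono[OF cone, of \<nu> "\<lambda>\<omega>. 0" "indicator B"] that
      ess_functional_const[of M G \<nu> 0] by (simp add: ess_bounded_const ess_bounded_indicator)
  \<comment> \<open>The empty event guarantees that the suprema \<open>s\<close> are taken over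
    non-empty sets.\<close>
  have N_empty: "{} \<in> N \<nu>" if "\<nu> \<in> ?F" for \<nu>
    using that ess_functional_const[of M G \<nu> 0] by (simp add: N_def indicator_def[abs_def])
  have N_sub: "B \<in> N \<nu>" if "\<nu> \<in> ?F" "C \<in> N \<nu>" "B \<in> events" "B \<subseteq> C" for \<nu> B C
  proof -
    have "ess_functional M G \<nu>" using that(1) by simp
    then have "\<nu> (indicator B) \<le> \<nu> (indicator C)"
      by (rule ess_functional_mono[OF cone]) (use that in \<open>auto simp: N_def ess_bounded_indicator indicator_def\<close>)
    with N_nn[OF that(1,3)] that show ?thesis by (simp add: N_def)
  qed
  have N_Un: "B \<union> C \<in> N \<nu>" if "\<nu> \<in> ?F" "B \<in> N \<nu>" "C \<in> N \<nu>" for \<nu> B C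
  proof -
    have BC: "B \<in> events" "C \<in> events" using that by (auto simp: N_def)
    have \<nu>: "ess_functional M G \<nu>" using that(1) by simp
    have "\<nu> (indicator (B \<union> C)) \<le> \<nu> (\<lambda>\<omega>. indicator B \<omega> + indicator C \<omega>)"
      by (intro ess_functional_mono[OF cone \<nu>] ess_bounded_add ess_bounded_indicator sets.Un BC)
        (simp add: indicator_def)
    also have "\<dots> = 0"
      using ess_functional_add[OF \<nu> ess_bounded_indicator ess_bounded_indicator, OF BC] that(2,3)
      by (simp add: N_def)
    finally show ?thesis using N_nn[OF that(1), of "B \<union> C"] BC by (simp add: N_def)
  qed
  have bdd: "bdd_above (prob ` N \<nu>)" for \<nu> by (auto intro: bdd_aboveI[of _ 1])
  have le_s: "prob B \<le> s \<nu>" if "B \<in> N \<nu>" for B \<nu>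
    unfolding s_def by (rule cSUP_upper[OF that bdd])
  have s_nn: "0 \<le> s \<nu>" if "\<nu> \<in> ?F" for \<nu> using le_s[OF N_empty[OF that]] by simp
  have bdd_s: "bdd_below (s ` ?F)" using s_nn by (auto intro!: bdd_belowI[of _ 0])
  have F_ne: "?F \<noteq> {}" using ess_functional_exists[OF cone one_notin] by blast
  define S where "S = (INF \<nu>\<in>?F. s \<nu>)"
  have S_le: "S \<le> s \<nu>" if "\<nu> \<in> ?F" for \<nu>
    unfolding S_def by (rule cINF_lower[OF bdd_s that])
  have "\<exists>\<nu>\<in>?F. s \<nu> < S + inverse (real (Suc n))" for n
  proof -
    have "S < S + inverse (real (Suc n))" by simp
    then show ?thesis using cINF_less_iff[OF F_ne bdd_s] by (simp only: S_def)
  qed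
  then obtain \<nu>' where \<nu>': "\<And>n. ess_functional M G (\<nu>' n)" "\<And>n. s (\<nu>' n) < S + inverse (real (Suc n))"
    by (metis mem_Collect_eq)
  \<comment> \<open>Null events of a mixture are null for all its components, so the mixture of the
    minimising sequence has \<open>s\<close> at most each \<open>s (\<nu>' n)\<close>.\<close>
  have combine: "\<exists>\<nu>\<in>?F. \<forall>n. N \<nu> \<subseteq> N (\<nu>s n)" if "\<And>n. \<nu>s n \<in> ?F" for \<nu>s :: "nat \<Rightarrow> _"
  proof -
    have \<nu>s: "ess_functional M G (\<nu>s n)" for n using that by simp
    show ?thesis
      using ess_functional_suminf[where \<nu> = \<nu>s, OF cone \<nu>s]
      by (intro bexI[of _ "\<lambda>f. \<Sum>n. (1/2)^Suc n * \<nu>s n f"])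
        (auto simp: N_def ess_bounded_indicator simp del: power_Suc)
  qed
  from combine[of \<nu>'] \<nu>'(1) obtain \<nu> where \<nu>: "\<nu> \<in> ?F" and sub: "\<And>n. N \<nu> \<subseteq> N (\<nu>' n)"
    by blast
  have s_mono: "s \<mu> \<le> s \<mu>'" if "\<mu> \<in> ?F" "N \<mu> \<subseteq> N \<mu>'" for \<mu> \<mu>'
    unfolding s_def using N_empty[OF that(1)] by (intro cSUP_subset_mono bdd that) auto
  have "s \<nu> \<le> S"
  proof (rule field_le_epsilon)
    fix e :: real assume "0 < e"
    then obtain n where "inverse (real (Suc n)) < e" using reals_Archimedean by blast
    with \<nu>'(2)[of n] s_mono[OF \<nu> sub, of n] show "s \<nu> \<le> S + e" by simp
  qed
  with S_le[OF \<nu>] have s_eq: "s \<nu> = S" by simp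
  have "S \<le> 0"
  proof (rule ccontr)
    assume "\<not> S \<le> 0"
    have "\<exists>B\<in>N \<nu>. S - inverse (real (Suc n)) < prob B" for n
    proof -
      have "S - inverse (real (Suc n)) < s \<nu>" by (simp add: s_eq)
      then show ?thesis unfolding s_def using N_empty[OF \<nu>] by (subst (asm) less_cSUP_iff[OF _ bdd]) auto
    qed
    then obtain B where B: "\<And>n. B n \<in> N \<nu>" "\<And>n. S - inverse (real (Suc n)) < prob (B n)"
      by metis
    have B_ev: "B n \<in> events" for n using B(1) by (auto simp: N_def)
    \<comment> \<open>\<open>\<nu>\<close> is only known to be finitely additive, so
      \<open>Z\<close> itself need not lie in \<open>N \<nu>\<close>. The argument uses that
      \<open>prob Z = S\<close> and that null events exceed \<open>Z\<close> only by probability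
      0.\<close>
    define Z where "Z = (\<Union>n. B n)"
    have Z: "Z \<in> events" using B_ev by (auto simp: Z_def)
    have Z_null: "prob (C - Z) = 0" if C: "C \<in> N \<nu>" for C
    proof -
      have C_ev: "C \<in> events" using C by (simp add: N_def)
      have "prob (C - Z) \<le> 0"
      proof (rule field_le_epsilon)
        fix e :: real assume "0 < e"
        then obtain n where n: "inverse (real (Suc n)) < e" using reals_Archimedean by blast
        \<comment> \<open>\<open>C \<union> B n\<close> is again null, so its probability is at most
          \<open>S\<close>, whereas \<open>B n\<close> alone already has probability more than
          \<open>S - 1/(n+1)\<close>.\<close>
        have "prob (C - Z) \<le> prob ((C \<union> B n) - B n)"
          using C_ev B_ev by (intro finite_measure_mono) (auto simp: Z_def)
        also have "\<dots> = prob (C \<union> B n) - prob (B n)"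
          using C_ev B_ev by (intro finite_measure_Diff) auto
        also have "\<dots> \<le> S - prob (B n)"
          using le_s[OF N_Un[OF \<nu> C B(1)[of n]]] by (simp add: s_eq)
        also have "\<dots> \<le> 0 + e" using B(2)[of n] n by simp
        finally show "prob (C - Z) \<le> 0 + e" .
      qed
      then show ?thesis by (simp add: measure_le_0_iff)
    qed
    have Z_le: "prob Z \<le> S"
    proof (rule LIMSEQ_le_const2)
      \<comment> \<open>The finite unions stay in \<open>N \<nu>\<close>, so the bound
        \<open>S\<close> passes to \<open>Z\<close> through continuity of \<open>prob\<close> from
        below.\<close>
      let ?U = "\<lambda>n. \<Union>i\<le>n. B i"
      have "(\<lambda>n. prob (?U n)) \<longlonglongrightarrow> prob (\<Union>n. ?U n)"
        using B_ev by (intro finite_Lim_measure_incseq) (fastforce simp: incseq_def)+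
      also have "(\<Union>n. ?U n) = Z" by (auto simp: Z_def)
      finally show "(\<lambda>n. prob (?U n)) \<longlonglongrightarrow> prob Z" .
      have "?U n \<in> N \<nu>" for n
        using N_Un[OF \<nu>] B(1) by (induction n) (simp_all add: atMost_Suc)
      then show "\<exists>N. \<forall>n\<ge>N. prob (?U n) \<le> S" using le_s[of _ \<nu>] by (auto simp: s_eq)
    qed
    have "S \<le> prob Z"
    proof (rule field_le_epsilon)
      fix e :: real assume "0 < e"
      then obtain n where n: "inverse (real (Suc n)) < e" using reals_Archimedean by blast
      have "prob (B n) \<le> prob Z" by (intro finite_measure_mono Z) (auto simp: Z_def)
      with n B(2)[of n] show "S \<le> prob Z + e" by simp
    qed
    with \<open>\<not> S \<le> 0\<close> have "0 < prob Z" by simp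
    from local_functional[OF Z this] obtain \<nu>1 \<epsilon> where \<nu>1: "\<nu>1 \<in> ?F" and e: "0 < \<epsilon>"
      and loc: "\<And>B. B \<in> events \<Longrightarrow> B \<subseteq> Z \<Longrightarrow> \<nu>1 (indicator B) = 0 \<Longrightarrow> prob B < (1 - \<epsilon>) * prob Z"
      by blast
    \<comment> \<open>The sequence takes \<open>\<nu>\<close> at index 0 and \<open>\<nu>1\<close>
      afterwards, so the mixture behind \<open>combine\<close> is the plain average of the
      two.\<close>
    have "\<exists>\<nu>2\<in>?F. \<forall>n::nat. N \<nu>2 \<subseteq> N (if n = 0 then \<nu> else \<nu>1)"
      using \<nu> \<nu>1 by (intro combine[of "\<lambda>n. if n = 0 then \<nu> else \<nu>1"]) simp
    then obtain \<nu>2 where \<nu>2: "\<nu>2 \<in> ?F"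
      and sub2: "\<And>n :: nat. N \<nu>2 \<subseteq> N (if n = 0 then \<nu> else \<nu>1)"
      by blast
    \<comment> \<open>A bound strictly below \<open>prob Z \<le> S\<close> contradicts the choice of
      \<open>S\<close> as an infimum.\<close>
    have "s \<nu>2 \<le> (1 - \<epsilon>) * prob Z"
      unfolding s_def
    proof (rule cSUP_least)
      show "N \<nu>2 \<noteq> {}" using N_empty[OF \<nu>2] by blast
      fix C assume "C \<in> N \<nu>2"
      then have C: "C \<in> N \<nu>" "C \<in> N \<nu>1" using sub2[of 0] sub2[of 1] by auto
      then have C_ev: "C \<in> events" by (simp add: N_def)
      \<comment> \<open>Outside \<open>Z\<close> the event \<open>C\<close> has probability 0 by
        \<open>Z_null\<close>; its part inside \<open>Z\<close> is null for \<open>\<nu>1\<close>,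
        so \<open>loc\<close> applies.\<close>
      have "prob C = prob (C \<inter> Z) + prob (C - Z)"
        using C_ev Z by (subst finite_measure_Union[symmetric]) (auto simp: Int_Diff_Un)
      also have "\<dots> = prob (C \<inter> Z)" using Z_null[OF C(1)] by simp
      also have "\<dots> < (1 - \<epsilon>) * prob Z"
        using N_sub[OF \<nu>1 C(2), of "C \<inter> Z"] C_ev Z by (intro loc) (auto simp: N_def)
      finally show "prob C \<le> (1 - \<epsilon>) * prob Z" by simp
    qed
    also have "\<dots> < prob Z" using e \<open>0 < prob Z\<close> by simp
    also have "\<dots> \<le> s \<nu>2" using Z_le S_le[OF \<nu>2] by simp
    finally show False by simp
  qed
  have "prob B = 0" if "B \<in> events" "\<nu> (indicator B) = 0" for B
  proof -
    have "prob B \<le> S" using le_s[of B \<nu>] that by (simp add: N_def s_eq)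
    with \<open>S \<le> 0\<close> measure_nonneg[of M B] show ?thesis by linarith
  qed
  with \<nu> show ?thesis using that by blast
qed

text \<open>The indicator of the event \<open>f \<ge> 1/(n+1)\<close> is a.e. at most
  \<open>(n+1) f\<close>. Hence \<open>\<nu> f \<le> 0\<close> would make each of these events null
  and so of probability 0, leaving \<open>f = 0\<close> a.e.\<close>

lemma ess_functional_pos:
  assumes \<nu>: "ess_functional M G \<nu>"
    and str: "\<And>B. B \<in> events \<Longrightarrow> \<nu> (indicator B) = 0 \<Longrightarrow> prob B = 0"
    and f: "f \<in> ess_bounded M" and nn: "AE \<omega> in M. 0 \<le> f \<omega>" and nz: "\<not> (AE \<omega> in M. f \<omega> = 0)"
  shows "0 < \<nu> f"
proof (rule ccontr)
  assume "\<not> 0 < \<nu> f"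
  have [measurable]: "f \<in> borel_measurable M" using f by (auto simp: ess_bounded_def)
  have "AE \<omega> in M. f \<omega> < inverse (real (Suc n))" for n
  proof -
    let ?c = "inverse (real (Suc n))" and ?B = "{\<omega> \<in> space M. inverse (real (Suc n)) \<le> f \<omega>}"
    have B: "?B \<in> events" by measurable
    have "AE \<omega> in M. ?c * indicator ?B \<omega> \<le> f \<omega>"
      using nn by eventually_elim (auto simp: indicator_def)
    then have "\<nu> (\<lambda>\<omega>. ?c * indicator ?B \<omega>) \<le> \<nu> f"
      by (intro ess_functional_mono[OF cone \<nu>] ess_bounded_scale ess_bounded_indicator f B)
    also have "\<nu> (\<lambda>\<omega>. ?c * indicator ?B \<omega>) = ?c * \<nu> (indicator ?B)"
      by (rule ess_functional_scale[OF \<nu> ess_bounded_indicator[OF B]])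
    finally have "?c * \<nu> (indicator ?B) \<le> 0" using \<open>\<not> 0 < \<nu> f\<close> by simp
    then have "\<nu> (indicator ?B) \<le> 0" by (simp add: mult_le_0_iff)
    moreover have "\<nu> (\<lambda>\<omega>. 0) \<le> \<nu> (indicator ?B)"
      by (intro ess_functional_mono[OF cone \<nu>] ess_bounded_const ess_bounded_indicator B) simp
    ultimately have "\<nu> (indicator ?B) = 0" by (simp add: ess_functional_const[OF \<nu>])
    from str[OF B this] have "AE \<omega> in M. \<omega> \<notin> ?B" using prob_eq_0[OF B] by simp
    then show ?thesis by (auto elim!: eventually_mono simp: not_le)
  qed
  then have "AE \<omega> in M. \<forall>n. f \<omega> < inverse (real (Suc n))" by (simp add: AE_all_countable)
  with nn have "AE \<omega> in M. f \<omega> = 0"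
  proof eventually_elim
    case (elim \<omega>)
    then have "f \<omega> \<le> 0" by (meson reals_Archimedean not_le order_less_asym)
    with elim show ?case by simp
  qed
  with nz show False by simp
qed

end

section \<open>Passage to equivalence classes\<close>

text \<open>This carries the hypotheses on classes over to the set of all representatives, where
  pointwise arguments are available.\<close>

lemma (in prob_space) arbitrage_free_cone_representatives:
  assumes C: "Linf_convex_cone M C" and cl: "closedin (Linf_topology M) C"
    and zero: "C \<inter> Linf_nonneg M = {Linf_zero M}"
    and neg: "Linf_minus M ` Linf_nonneg M \<subseteq> C"
  shows "arbitrage_free_cone M {f \<in> ess_bounded M. Linf_class M f \<in> C}"
proof
  let ?G = "{f \<in> ess_bounded M. Linf_class M f \<in> C}"
  have scale: "Linf_scale M c X \<in> C" if "0 \<le> c" "X \<in> C" for c X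
    using C that by (simp add: Linf_convex_cone_def)
  show "ess_cone M ?G"
    unfolding ess_cone_def
  proof (intro conjI ballI allI impI)
    show "?G \<subseteq> ess_bounded M" by blast
  next
    fix f g assume f: "f \<in> ?G" and g: "g \<in> ?G"
    then have fg: "f \<in> ess_bounded M" "g \<in> ess_bounded M" by auto
    \<comment> \<open>Convexity supplies the midpoint of \<open>f\<close> and \<open>g\<close>; the
      cone property doubles it to the sum.\<close>
    have "Linf_add M (Linf_scale M (1/2) (Linf_class M f)) (Linf_scale M (1/2) (Linf_class M g)) \<in> C"
      using C f g unfolding Linf_convex_cone_def Linf_convex_def by auto
    then have "Linf_class M (\<lambda>\<omega>. 1/2 * f \<omega> + 1/2 * g \<omega>) \<in> C"
      using fg by (simp only: Linf_scale_class Linf_add_class ess_bounded_scale)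
    then have "Linf_scale M 2 (Linf_class M (\<lambda>\<omega>. 1/2 * f \<omega> + 1/2 * g \<omega>)) \<in> C"
      by (intro scale) simp_all
    also have "Linf_scale M 2 (Linf_class M (\<lambda>\<omega>. 1/2 * f \<omega> + 1/2 * g \<omega>))
        = Linf_class M (\<lambda>\<omega>. 2 * (1/2 * f \<omega> + 1/2 * g \<omega>))"
      by (intro Linf_scale_class ess_bounded_add ess_bounded_scale fg)
    finally show "(\<lambda>\<omega>. f \<omega> + g \<omega>) \<in> ?G"
      using ess_bounded_add[OF fg] by simp
  next
    fix c :: real and f assume "0 \<le> c" "f \<in> ?G"
    then show "(\<lambda>\<omega>. c * f \<omega>) \<in> ?G"
      using scale[of c "Linf_class M f"] by (auto simp: Linf_scale_class ess_bounded_scale)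
  next
    fix f assume f: "f \<in> ess_bounded M" and le: "AE \<omega> in M. f \<omega> \<le> 0"
    have f': "(\<lambda>\<omega>. - f \<omega>) \<in> ess_bounded M"
      using ess_bounded_scale[OF f, of "- 1"] by simp
    have "Linf_class M (\<lambda>\<omega>. - f \<omega>) \<in> Linf_nonneg M"
      using le by (simp add: Linf_nonneg_class[OF f'])
    then have "Linf_minus M (Linf_class M (\<lambda>\<omega>. - f \<omega>)) \<in> C" using neg by blast
    then show "f \<in> ?G" using f by (simp add: Linf_minus_class[OF f'])
  qed
  show "f \<in> ?G" if f: "f \<in> ess_bounded M" and e: "\<And>e. 0 < e \<Longrightarrow> (\<lambda>\<omega>. f \<omega> - e) \<in> ?G" for f
  proof (rule ccontr)
    assume "f \<notin> ?G"
    then have "Linf_class M f \<in> Linf M - C" using f by (simp add: Linf_class_in_Linf)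
    moreover have "openin (Linf_topology M) (Linf M - C)"
      using cl by (simp add: closedin_def topspace_Linf_topology)
    ultimately obtain r where r: "0 < r"
      and ball: "Metric_space.mball (Linf M) (Linf_dist M) (Linf_class M f) r \<subseteq> Linf M - C"
      unfolding Linf_topology_def Metric_space.openin_mtopology[OF Metric_space_Linf] by blast
    \<comment> \<open>The function \<open>f - r / 2\<close> represents a point of the ball of radius
      \<open>r\<close> about the class of \<open>f\<close>, which misses \<open>C\<close>; the half
      leaves room for the strict inequality.\<close>
    have fe: "(\<lambda>\<omega>. f \<omega> - r / 2) \<in> ess_bounded M" and inC: "Linf_class M (\<lambda>\<omega>. f \<omega> - r / 2) \<in> C"
      using e[of "r / 2"] r by auto
    have "Linf_dist M (Linf_class M f) (Linf_class M (\<lambda>\<omega>. f \<omega> - r / 2)) \<le> r / 2"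
      using r by (subst Linf_dist_le_iff[OF f fe]) simp
    then have "Linf_class M (\<lambda>\<omega>. f \<omega> - r / 2) \<in>
        Metric_space.mball (Linf M) (Linf_dist M) (Linf_class M f) r"
      using r by (simp add: Metric_space.in_mball[OF Metric_space_Linf] Linf_class_in_Linf f fe)
    with ball inC show False by blast
  qed
  show "AE \<omega> in M. f \<omega> = 0" if f: "f \<in> ?G" and nn: "AE \<omega> in M. 0 \<le> f \<omega>" for f
  proof -
    have "Linf_class M f \<in> C \<inter> Linf_nonneg M" using f nn by (simp add: Linf_nonneg_class)
    then have "Linf_class M f = Linf_class M (\<lambda>\<omega>. 0)" using zero by (simp add: Linf_zero_def)
    then show ?thesis using f by (simp add: Linf_class_eq_iff ess_bounded_const)
  qed
qed

text \<open>The Lipschitz constant 1 is the one that normalised functionals satisfy; with it a ball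
  in the reals pulls back to a set containing a ball of the same radius.\<close>

lemma (in prob_space) continuous_map_Linf:
  assumes "\<And>X Y. X \<in> Linf M \<Longrightarrow> Y \<in> Linf M \<Longrightarrow> \<bar>\<mu> X - \<mu> Y\<bar> \<le> Linf_dist M X Y"
  shows "continuous_map (Linf_topology M) euclideanreal \<mu>"
  unfolding continuous_map_def topspace_Linf_topology
proof (intro conjI allI impI)
  fix U :: "real set" assume "openin euclideanreal U"
  then have U: "open U" by simp
  have "\<exists>r>0. Metric_space.mball (Linf M) (Linf_dist M) X r \<subseteq> {X \<in> Linf M. \<mu> X \<in> U}"
    if X: "X \<in> Linf M" "\<mu> X \<in> U" for X
  proof -
    obtain r where r: "0 < r" "\<And>y. dist y (\<mu> X) < r \<Longrightarrow> y \<in> U"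
      using U X(2) unfolding open_dist by blast
    have "\<mu> Y \<in> U" if "Y \<in> Linf M" "Linf_dist M X Y < r" for Y
      using assms[OF X(1) that(1)] that(2) by (intro r(2)) (simp add: dist_real_def abs_minus_commute)
    then show ?thesis
      using r(1) by (intro exI[of _ r]) (auto simp: Metric_space.in_mball[OF Metric_space_Linf])
  qed
  then show "openin (Linf_topology M) {X \<in> Linf M. \<mu> X \<in> U}"
    unfolding Linf_topology_def Metric_space.openin_mtopology[OF Metric_space_Linf] by blast
qed simp

theorem theorem2:
  fixes P :: "'a measure" and C :: "('a \<Rightarrow> real) set set"
  assumes "prob_space P"
    and "Linf_convex_cone P C"
    and "closedin (Linf_topology P) C"
    and "C \<inter> Linf_nonneg P = {Linf_zero P}"
    and "Linf_minus P ` Linf_nonneg P \<subseteq> C"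
  shows "\<exists>\<mu> :: ('a \<Rightarrow> real) set \<Rightarrow> real.
    Linf_linear P \<mu> \<and>
    continuous_map (Linf_topology P) euclideanreal \<mu> \<and>
    (\<forall>x \<in> Linf_nonneg P - {Linf_zero P}. 0 < \<mu> x) \<and>
    (\<forall>x \<in> C. \<mu> x \<le> 0)"
proof -
  let ?G = "{f \<in> ess_bounded P. Linf_class P f \<in> C}"
  interpret prob_space P by fact
  interpret arbitrage_free_cone P ?G
    by (rule arbitrage_free_cone_representatives) fact+
  obtain \<nu> where \<nu>: "ess_functional P ?G \<nu>"
    and str: "\<And>B. B \<in> sets P \<Longrightarrow> \<nu> (indicator B) = 0 \<Longrightarrow> prob B = 0"
    using strictly_positive_functional by blast
  \<comment> \<open>Any representative may be chosen: monotonicity of \<open>\<nu>\<close> in both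
    directions makes the value independent of the choice.\<close>
  define \<mu> where "\<mu> X = \<nu> (SOME f. f \<in> X)" for X
  have \<mu>: "\<mu> (Linf_class P f) = \<nu> f" if f: "f \<in> ess_bounded P" for f
  proof -
    let ?g = "SOME g. g \<in> Linf_class P f"
    have "f \<in> Linf_class P f" using f by (simp add: in_Linf_class ae_rel_def)
    then have "?g \<in> Linf_class P f" by (rule someI[of "\<lambda>g. g \<in> Linf_class P f"])
    then have g: "?g \<in> ess_bounded P" and eq: "AE \<omega> in P. f \<omega> = ?g \<omega>"
      by (auto simp: in_Linf_class ae_rel_def)
    from eq have "AE \<omega> in P. f \<omega> \<le> ?g \<omega>" "AE \<omega> in P. ?g \<omega> \<le> f \<omega>"
      by (auto elim: eventually_mono)
    then show ?thesis
      using ess_functional_mono[OF cone \<nu> f g] ess_functional_mono[OF cone \<nu> g f]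
      by (simp add: \<mu>_def)
  qed
  have lin: "Linf_linear P \<mu>"
    unfolding Linf_linear_def
  proof (intro conjI ballI allI)
    fix X Y assume "X \<in> Linf P" "Y \<in> Linf P"
    then obtain f g where "f \<in> ess_bounded P" "X = Linf_class P f"
      "g \<in> ess_bounded P" "Y = Linf_class P g"
      by (meson Linf_cases)
    then show "\<mu> (Linf_add P X Y) = \<mu> X + \<mu> Y"
      by (simp add: Linf_add_class \<mu> ess_bounded_add ess_functional_add[OF \<nu>])
  next
    fix c X assume "X \<in> Linf P"
    then obtain f where "f \<in> ess_bounded P" "X = Linf_class P f" by (rule Linf_cases)
    then show "\<mu> (Linf_scale P c X) = c * \<mu> X"
      by (simp add: Linf_scale_class \<mu> ess_bounded_scale ess_functional_scale[OF \<nu>])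
  qed
  have cont: "continuous_map (Linf_topology P) euclideanreal \<mu>"
  proof (rule continuous_map_Linf)
    fix X Y assume "X \<in> Linf P" "Y \<in> Linf P"
    then obtain f g where f: "f \<in> ess_bounded P" "X = Linf_class P f"
      and g: "g \<in> ess_bounded P" "Y = Linf_class P g"
      by (meson Linf_cases)
    have "AE \<omega> in P. \<bar>f \<omega> - g \<omega>\<bar> \<le> Linf_dist P X Y"
      using Linf_dist_le_iff[OF f(1) g(1)] f(2) g(2) by blast
    from ess_functional_abs_le[OF cone \<nu> ess_bounded_diff[OF f(1) g(1)] this]
    show "\<bar>\<mu> X - \<mu> Y\<bar> \<le> Linf_dist P X Y"
      using f g by (simp add: \<mu> ess_functional_diff[OF \<nu>])
  qed
  have pos: "0 < \<mu> X" if "X \<in> Linf_nonneg P - {Linf_zero P}" for X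
  proof -
    from that have "X \<in> Linf P" by (simp add: Linf_nonneg_def)
    then obtain f where f: "f \<in> ess_bounded P" "X = Linf_class P f" by (rule Linf_cases)
    have "AE \<omega> in P. 0 \<le> f \<omega>" "\<not> (AE \<omega> in P. f \<omega> = 0)"
      using that f by (auto simp: Linf_nonneg_class Linf_zero_def Linf_class_eq_iff ess_bounded_const)
    from ess_functional_pos[OF \<nu> str f(1) this] show ?thesis
      using f by (simp add: \<mu>)
  qed
  have npos: "\<mu> X \<le> 0" if "X \<in> C" for X
  proof -
    have "X \<in> Linf P" using that assms(2) by (auto simp: Linf_convex_cone_def Linf_convex_def)
    then obtain f where f: "f \<in> ess_bounded P" "X = Linf_class P f" by (rule Linf_cases)
    then show ?thesis using ess_functional_nonpos[OF \<nu>, of f] that by (simp add: \<mu>)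
  qed
  from lin cont pos npos show ?thesis by blast
qed

end
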